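(* Let $X$ be a smooth projective complex curve of genus $0$ with a marked point $\infty$ and a formal coordinate $z$ at $\infty$, let $G$ be a semisimple simply-connected complex group, and let $A\subset LG$ be a regular Heisenberg subgroup with elliptic monodromy. Then for every string point $P\in\widehat{\mathrm{Gr}}_X$ the associated vector bundle $c$ on $X_0=X\setminus\infty$ vanishes: $c=0$.
   Context: Notation. $D=\operatorname{Spec}\mathbf C[[z]]$, $D^\times=\operatorname{Spec}\mathbf C((z))$; $LG=\operatorname{Map}(D^\times,G)$. $H\subset G$ is a Cartan subgroup with Lie algebra $\mathfrak h$, normalizer $N(H)$ and Weyl group $W=N(H)/H$. $G/N(H)$ parametrizes Cartan subgroups of $G$ (centralizers of regular semisimple elements of $\mathfrak g$); $\widetilde{G/N(H)}\supset G/N(H)$ parametrizes centralizers of regular elements of $\mathfrak g$; both carry a universal abelian group scheme. Heisenberg subgroups. A Heisenberg subgroup $A\subset LG$ is a maximal torus of the constant group scheme $G\times D^\times$ over $D^\times$, i.e. a map $C_A:D^\times\to G/N(H)$; $\underline A\to D^\times$ is the pullback of the universal group scheme, $A$ its group of sections, $\mathfrak a$ its Lie algebra. $A$ is regular if $C_A$ extends to $D\to\widetilde{G/N(H)}$; then $\underline A$ extends to an abelian group scheme $\underline A_+\to D$. The cameral cover $p:D^\times[A]\to D^\times$ is the pullback of the $W$-torsor $G/H\to G/N(H)$ along $C_A$; its monodromy around the puncture is a conjugacy class in $W$, called the monodromy of $A$. An element $w\in W$ is elliptic if it has no nonzero fixed vectors in $\mathfrak h$. Grassmannian. The completed neighbourhood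 of $\infty$ is identified with $D$ by $z$. $\widehat{\mathrm{Gr}}_X$ parametrizes $G$-torsors $P\to X$ together with a reduction of $P|_D$ to an $\underline A_+$-torsor $E$ and a trivialization of $E$. This identifies $H^0(D^\times,\operatorname{ad}P)\cong L\mathfrak g$ and $H^0(D^\times,\operatorname{ad}E)\cong\mathfrak a$. Atiyah bundles. For a $G$-torsor $\pi:P\to X$, $\operatorname{ad}P=(\pi_*T_{P/X})^G$ and $\mathcal A_P=(\pi_*T_P)^G$. For an $\underline A$-torsor $E$ on $D^\times$ let $E[A]$ be the $H$-torsor on $D^\times[A]$ obtained by pullback (the pullback of $\underline A$ to $D^\times[A]$ is canonically the constant group $H$), and set $\mathcal A_E=(p_*\mathcal A_{E[A]})^W$, so $0\to\operatorname{ad}E\to\mathcal A_E\to T_{D^\times}\to0$. The embedding $\mathcal A_E\subset\mathcal A_P|_{D^\times}$: $E$ corresponds to an $N(H)$-torsor $Q$ with $Q\times^{N(H)}W\cong D^\times[A]$ and $P|_{D^\times}\cong Q\times^{N(H)}G$; $\mathcal A_E$ is identified with the $N(H)$-invariant vector fields on $Q$, which induce $G$-invariant vector fields on $P|_{D^\times}$. String points. $\mathcal A_{stab}=H^0(D^\times,\mathcal A_E)\cap H^0(X_0,\mathcal A_P)$ inside $H^0(D^\times,\mathcal A_P)$. The point $P$ is string if the natural map $\mathcal A_{stab}\to H^0(X_0,T_X)$ is surjective. The bundle $c$. $\mathcal A^0_{stab}=\mathfrak a\cap H^0(X_0,\operatorname{ad}P)$ inside $H^0(D^\times,\operatorname{ad}P)$;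 it is a finitely generated projective $\mathcal O(X_0)$-module and $c=\mathcal A^0_{stab}\otimes_{\mathcal O(X_0)}\mathcal O_{X_0}$ is the corresponding vector bundle on $X_0$. *)

theory Defs
  imports
    "HOL-Analysis.Analysis"
    "HOL-Algebra.Solvable_Groups"
    "HOL-Library.Poly_Mapping"
    "HOL-Computational_Algebra.Formal_Laurent_Series"
    "HOL-Computational_Algebra.Polynomial"
begin

section \<open>Matrices and spans over subrings\<close>

definition span_over :: "('r \<Rightarrow> 'm \<Rightarrow> 'm::comm_monoid_add) \<Rightarrow> 'r set \<Rightarrow> 'm set \<Rightarrow> 'm set" where
  "span_over sc R S = {\<Sum>s\<in>T. sc (a s) s | T a. finite T \<and> T \<subseteq> S \<and> a ` T \<subseteq> R}"

definition mat_scale :: "'r::times \<Rightarrow> 'r^'n^'m \<Rightarrow> 'r^'n^'m" where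
  "mat_scale c M = map_matrix (\<lambda>x. c * x) M"

definition mat_group :: "('r::comm_ring_1^'n^'n) set \<Rightarrow> ('r^'n^'n) monoid" where
  "mat_group S = \<lparr>carrier = S, monoid.mult = (**), one = mat 1\<rparr>"

section \<open>Pointed curves with a formal coordinate\<close>

text \<open>
  A smooth projective curve is given by its function field, its points being the valuation rings
  of the field over the constants.  A formal coordinate \<open>z\<close> at a point identifies the completed
  local ring with formal power series in \<open>z\<close>; expanding rational functions embeds the function
  field into the field of formal Laurent series in \<open>z\<close>, and we identify it with its image \<open>F\<close>.
  The marked point is then the one at which \<open>z\<close>-expansions have no pole, and \<open>z\<close> being a
  coordinate of the completion means that \<open>F\<close> contains a series of order one.
\<close>

definition subalg :: "complex fls set \<Rightarrow> bool" where
  "subalg R \<longleftrightarrow> range fls_const \<subseteq> R \<and> (\<forall>x\<in>R. \<forall>y\<in>R. x - y \<in> R \<and> x * y \<in> R)"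

definition rational_in :: "complex fls \<Rightarrow> complex fls set" where
  "rational_in t = {poly (map_poly fls_const p) t / poly (map_poly fls_const r) t | p r. True}"

text \<open>
  As the constants are algebraically closed, a nonconstant \<open>t\<close> is transcendental over them.
\<close>

definition function_field :: "complex fls set \<Rightarrow> bool" where
  "function_field F \<longleftrightarrow> subalg F \<and> (\<forall>x\<in>F. inverse x \<in> F) \<and>
     (\<exists>t\<in>F. t \<notin> range fls_const \<and> (\<exists>B. finite B \<and> F = span_over (*) (rational_in t) B))"

definition pointed_curve :: "complex fls set \<Rightarrow> bool" where
  "pointed_curve F \<longleftrightarrow> function_field F \<and> (\<exists>s\<in>F. fls_subdegree s = 1)"

definition points :: "complex fls set \<Rightarrow> complex fls set set" where
  "points F = {R. subalg R \<and> R \<subset> F \<and> (\<forall>x\<in>F. x \<in> R \<or> inverse x \<in> R)}"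

definition infinity_pt :: "complex fls set \<Rightarrow> complex fls set" where
  "infinity_pt F = {x\<in>F. fls_subdegree x \<ge> 0}"

definition affine_part :: "complex fls set \<Rightarrow> complex fls set set" where
  "affine_part F = points F - {infinity_pt F}"

definition regular_functions :: "complex fls set \<Rightarrow> complex fls set set \<Rightarrow> complex fls set" where
  "regular_functions F U = {x\<in>F. \<forall>R\<in>U. x \<in> R}"

text \<open>
  The genus is the dimension of the first cohomology of the structure sheaf.  By the flasque
  resolution of the structure sheaf by the constant sheaf \<open>F\<close> and the sheaf of principal parts,
  this cohomology is the space of repartitions modulo those which are the sum of a constant family
  and an everywhere regular one.  In \<open>has_genus F g\<close> the family \<open>b\<close> is a basis of this quotient.
\<close>

definition repartition :: "complex fls set \<Rightarrow> (complex fls set \<Rightarrow> complex fls) \<Rightarrow> bool" where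
  "repartition F r \<longleftrightarrow> (\<forall>R\<in>points F. r R \<in> F) \<and> finite {R\<in>points F. r R \<notin> R}"

definition has_genus :: "complex fls set \<Rightarrow> nat \<Rightarrow> bool" where
  "has_genus F g \<longleftrightarrow> (\<exists>b. (\<forall>i<g. repartition F (b i)) \<and>
     (\<forall>r. repartition F r \<longrightarrow>
        (\<exists>!c :: nat \<Rightarrow> complex. (\<forall>i\<ge>g. c i = 0) \<and>
           (\<exists>f\<in>F. \<forall>R\<in>points F. r R - (\<Sum>i<g. fls_const (c i) * b i R) - f \<in> R))))"

text \<open>
  Derivations of the coordinate ring of the affine part, as multiples of \<open>d/dz\<close>.
\<close>

definition vector_fields :: "complex fls set \<Rightarrow> complex fls set" where
  "vector_fields F = {f. \<forall>x\<in>regular_functions F (affine_part F).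
      f * fls_deriv x \<in> regular_functions F (affine_part F)}"

section \<open>Linear algebraic groups and their Lie algebras\<close>

type_synonym 'n mat_poly = "(('n \<times> 'n) \<Rightarrow>\<^sub>0 nat) \<Rightarrow>\<^sub>0 complex"

definition eval_at :: "(complex \<Rightarrow> 'r::comm_ring_1) \<Rightarrow> 'n mat_poly \<Rightarrow> 'r^'n^'n \<Rightarrow> 'r" where
  "eval_at h p x = (\<Sum>m\<in>Poly_Mapping.keys p. h (Poly_Mapping.lookup p m) *
      (\<Prod>ij\<in>Poly_Mapping.keys m. (x $ fst ij $ snd ij) ^ Poly_Mapping.lookup m ij))"

definition vanishing_ideal :: "(complex^'n^'n) set \<Rightarrow> 'n mat_poly set" where
  "vanishing_ideal Z = {p. \<forall>x\<in>Z. eval_at id p x = 0}"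

text \<open>
  Points, with values in the ring to which \<open>h\<close> maps the complex numbers, of the reduced Zariski
  closure of \<open>Z\<close> in the general linear group.
\<close>

definition pts :: "(complex \<Rightarrow> 'r::comm_ring_1) \<Rightarrow> (complex^'n^'n) set \<Rightarrow> ('r^'n^'n) set" where
  "pts h Z = {x. invertible x \<and> (\<forall>p\<in>vanishing_ideal Z. eval_at h p x = 0)}"

abbreviation loop_pts :: "(complex^'n^'n) set \<Rightarrow> (complex fls^'n^'n) set" where
  "loop_pts \<equiv> pts fls_const"

definition zariski_closed :: "(complex^'n^'n) set \<Rightarrow> bool" where
  "zariski_closed Z \<longleftrightarrow> pts id Z = Z"

definition algebraic_group :: "(complex^'n^'n) set \<Rightarrow> bool" where
  "algebraic_group G \<longleftrightarrow> subgroup G (mat_group {x. invertible x}) \<and> zariski_closed G"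

text \<open>
  For algebraic groups, connectedness in the classical and in the Zariski topology agree.
\<close>

definition semisimple_group :: "(complex^'n^'n) set \<Rightarrow> bool" where
  "semisimple_group G \<longleftrightarrow> algebraic_group G \<and> connected G \<and>
     (\<forall>R. R \<lhd> mat_group G \<and> zariski_closed R \<and> connected R \<and> solvable (mat_group R)
        \<longrightarrow> R = {mat 1})"

text \<open>
  \<open>X\<close> is tangent to \<open>G\<close> at the identity when \<open>1 + \<epsilon> X\<close> satisfies the equations of \<open>G\<close> modulo
  \<open>\<epsilon>\<^sup>2\<close>; here \<open>\<epsilon>\<close> is the variable of a polynomial ring.
\<close>

definition lie_algebra :: "(complex^'n^'n) set \<Rightarrow> (complex^'n^'n) set" where
  "lie_algebra G = {X. \<forall>p\<in>vanishing_ideal G.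
     [:0, 1:]\<^sup>2 dvd eval_at (\<lambda>c. [:c:]) p (mat 1 + map_matrix (\<lambda>c. [:0, c:]) X)}"

definition mat_coeff :: "complex fls^'n^'n \<Rightarrow> int \<Rightarrow> complex^'n^'n" where
  "mat_coeff M k = map_matrix (\<lambda>x. fls_nth x k) M"

definition loop_lie :: "(complex^'n^'n) set \<Rightarrow> (complex fls^'n^'n) set" where
  "loop_lie G = {M. \<forall>k. mat_coeff M k \<in> lie_algebra G}"

definition torus :: "(complex^'n^'n) set \<Rightarrow> bool" where
  "torus T \<longleftrightarrow> algebraic_group T \<and> connected T \<and>
     (\<exists>B :: complex^'n^'n. invertible B \<and> (\<forall>t\<in>T. \<forall>i j. i \<noteq> j \<longrightarrow> (matrix_inv B ** t ** B) $ i $ j = 0))"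

definition cartan_subgroup :: "(complex^'n^'n) set \<Rightarrow> (complex^'n^'n) set \<Rightarrow> bool" where
  "cartan_subgroup H G \<longleftrightarrow> torus H \<and> H \<subseteq> G \<and> (\<forall>T. torus T \<and> H \<subseteq> T \<and> T \<subseteq> G \<longrightarrow> T = H)"

definition norm_group :: "(complex^'n^'n) set \<Rightarrow> (complex^'n^'n) set \<Rightarrow> (complex^'n^'n) set" where
  "norm_group G H = {x\<in>G. (\<lambda>h. x ** h ** matrix_inv x) ` H = H}"

definition weyl_group ::
  "(complex^'n^'n) set \<Rightarrow> (complex^'n^'n) set \<Rightarrow> (complex^'n^'n) set monoid" where
  "weyl_group G H = mat_group (norm_group G H) Mod H"

definition elliptic :: "(complex^'n^'n) set \<Rightarrow> (complex^'n^'n) set \<Rightarrow> bool" where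
  "elliptic H w \<longleftrightarrow>
     (\<forall>X\<in>lie_algebra H. (\<forall>n\<in>w. n ** X ** matrix_inv n = X) \<longrightarrow> X = 0)"

definition lie_centralizer :: "(complex^'n^'n) set \<Rightarrow> complex^'n^'n \<Rightarrow> (complex^'n^'n) set" where
  "lie_centralizer G X = {Y\<in>lie_algebra G. X ** Y = Y ** X}"

text \<open>
  The operator \<open>dim\<close> is the real dimension, twice the complex one on both sides.
\<close>

definition regular_element ::
  "(complex^'n^'n) set \<Rightarrow> (complex^'n^'n) set \<Rightarrow> complex^'n^'n \<Rightarrow> bool" where
  "regular_element G H X \<longleftrightarrow>
     X \<in> lie_algebra G \<and> dim (lie_centralizer G X) = dim (lie_algebra H)"

section \<open>Heisenberg subgroups\<close>

text \<open>
  A map from the punctured disc to \<open>G/N(H)\<close> lifts to \<open>G\<close> after an etale cover, and the connected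
  etale covers of the punctured disc are \<open>z = u\<^sup>d\<close>.  A Heisenberg subgroup is therefore given by
  \<open>d\<close> and a \<open>G\<close>-valued Laurent series \<open>q\<close> in \<open>u\<close> whose class modulo \<open>N(H)\<close> is invariant under
  the deck transformation.  The subgroup itself consists of the Laurent series in \<open>z\<close> whose
  pull-back lies in \<open>q H q\<^sup>-\<^sup>1\<close>.
\<close>

definition pull :: "nat \<Rightarrow> complex fls \<Rightarrow> complex fls" where
  "pull d f = fls_compose_power f d"

definition deck :: "nat \<Rightarrow> complex fls \<Rightarrow> complex fls" where
  "deck d f = fls_compose_fps f (fps_const (cis (2 * pi / real d)) * fps_X)"

text \<open>
  From \<open>z = u\<^sup>d\<close> one has \<open>d/dz = (1/d) u\<^sup>1\<^sup>-\<^sup>d d/du\<close>.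
\<close>

definition dz :: "nat \<Rightarrow> complex fls \<Rightarrow> complex fls" where
  "dz d f = fls_const (1 / of_nat d) * fls_X_intpow (1 - int d) * fls_deriv f"

definition heisenberg ::
  "(complex^'n^'n) set \<Rightarrow> (complex^'n^'n) set \<Rightarrow> nat \<Rightarrow> complex fls^'n^'n \<Rightarrow> bool" where
  "heisenberg G H d q \<longleftrightarrow> d > 0 \<and> q \<in> loop_pts G \<and>
     matrix_inv q ** map_matrix (deck d) q \<in> loop_pts (norm_group G H)"

text \<open>
  The pull-back of \<open>G/H \<rightarrow> G/N(H)\<close> acquires the section given by \<open>q\<close> over the cover, so its
  monodromy is the class in \<open>W\<close> comparing \<open>q\<close> with its deck transform.  Another choice of \<open>q\<close>
  conjugates \<open>w\<close>.
\<close>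

definition has_monodromy :: "(complex^'n^'n) set \<Rightarrow> (complex^'n^'n) set \<Rightarrow> nat \<Rightarrow>
    complex fls^'n^'n \<Rightarrow> (complex^'n^'n) set \<Rightarrow> bool" where
  "has_monodromy G H d q w \<longleftrightarrow> w \<in> carrier (weyl_group G H) \<and>
     matrix_inv q ** map_matrix (deck d) q \<in> loop_pts w"

definition heis_lie :: "(complex^'n^'n) set \<Rightarrow> (complex^'n^'n) set \<Rightarrow> nat \<Rightarrow>
    complex fls^'n^'n \<Rightarrow> (complex fls^'n^'n) set" where
  "heis_lie G H d q =
     {M\<in>loop_lie G. matrix_inv q ** map_matrix (pull d) M ** q \<in> loop_lie H}"

text \<open>
  A map from the disc to the variety of centralizers of regular elements, viewed inside the
  Grassmannian of the Lie algebra, is a saturated submodule \<open>L\<close> of the Lie algebra over power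
  series.  That variety is open in the variety of abelian subalgebras of dimension the rank, so
  for \<open>L\<close> extending the Heisenberg algebra only the fibre at \<open>z = 0\<close> has to be constrained.
\<close>

definition regular_heisenberg ::
  "(complex^'n^'n) set \<Rightarrow> (complex^'n^'n) set \<Rightarrow> nat \<Rightarrow> complex fls^'n^'n \<Rightarrow> bool" where
  "regular_heisenberg G H d q \<longleftrightarrow> heisenberg G H d q \<and>
     (\<exists>L. L \<subseteq> {M\<in>loop_lie G. \<forall>k<0. mat_coeff M k = 0} \<and>
        L = span_over mat_scale (range fps_to_fls) L \<and>
        (\<forall>M\<in>loop_lie G. (\<forall>k<0. mat_coeff M k = 0) \<and> mat_scale fls_X M \<in> L \<longrightarrow> M \<in> L) \<and>
        heis_lie G H d q = {mat_scale (fls_X_intpow k) M | k M. M \<in> L} \<and>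
        (\<exists>X. regular_element G H X \<and> (\<lambda>M. mat_coeff M 0) ` L = lie_centralizer G X))"

section \<open>Torsors\<close>

text \<open>
  An etale neighbourhood of the point \<open>R\<close>: a finite extension \<open>F'\<close> of \<open>F\<close>, realised in Laurent
  series in \<open>u\<close> with \<open>z = u\<^sup>d\<close>, and a point \<open>R'\<close> of \<open>F'\<close> over \<open>R\<close>, unramified over \<open>R\<close>.
\<close>

definition etale_nbhd :: "complex fls set \<Rightarrow> complex fls set \<Rightarrow> nat \<Rightarrow> complex fls set \<Rightarrow>
    complex fls set \<Rightarrow> bool" where
  "etale_nbhd F R d F' R' \<longleftrightarrow> d > 0 \<and> function_field F' \<and> pull d ` F \<subseteq> F' \<and>
     (\<exists>B. finite B \<and> F' = span_over (*) (pull d ` F) B) \<and>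
     R' \<in> points F' \<and> R' \<inter> pull d ` F = pull d ` R \<and>
     (\<exists>s\<in>R. {x\<in>R'. x = 0 \<or> inverse x \<notin> R'} = {pull d s * y | y. y \<in> R'})"

text \<open>
  With \<open>F'\<close> given inside Laurent series in \<open>u\<close>, \<open>z = u\<^sup>d\<close>, and the target being Laurent series in
  \<open>v\<close>, \<open>z = v\<^sup>e\<close>.  Up to enlarging \<open>e\<close>, these embeddings are the branches of \<open>F'\<close> over the
  punctured disc.
\<close>

definition embedding_over :: "complex fls set \<Rightarrow> nat \<Rightarrow> complex fls set \<Rightarrow> nat \<Rightarrow>
    (complex fls \<Rightarrow> complex fls) \<Rightarrow> bool" where
  "embedding_over F d F' e \<tau> \<longleftrightarrow> e > 0 \<and> (\<forall>x\<in>F. \<tau> (pull d x) = pull e x) \<and>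
     (\<forall>x\<in>F'. \<forall>y\<in>F'. \<tau> (x + y) = \<tau> x + \<tau> y \<and> \<tau> (x * y) = \<tau> x * \<tau> y)"

text \<open>
  A torsor on the curve, trivialised on the disc \<open>D\<close>, is the same as a torsor \<open>P\<close> on the affine
  part, trivialised on the punctured disc.  Since \<open>G\<close> is a closed subgroup of the general linear
  group, \<open>P\<close> is the same as a vector bundle with a reduction of its frame bundle to \<open>G\<close>.
  The sections of the bundle over the affine part form a module \<open>V\<close>, embedded into the
  Laurent series vectors by the trivialisation; it is finitely generated, with a local frame
  (the columns of \<open>\<delta>\<close>) at every point.  The reduction is determined by the trivialisation, being
  \<open>G\<close> itself over the punctured disc, and it is a torsor if it has sections etale locally: a
  section over the neighbourhood \<open>R'\<close> is a frame \<open>\<delta> \<epsilon>\<close>, where \<open>\<epsilon>\<close> is an invertible matrix over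
  \<open>R'\<close>, which lies in \<open>G\<close> on every branch of the neighbourhood over the punctured disc.
\<close>

definition torsor_module ::
  "complex fls set \<Rightarrow> (complex^'n^'n) set \<Rightarrow> (complex fls^'n) set \<Rightarrow> bool" where
  "torsor_module F G V \<longleftrightarrow>
     (\<exists>B. finite B \<and> V = span_over (*s) (regular_functions F (affine_part F)) B) \<and>
     (\<forall>R\<in>affine_part F. \<exists>\<delta> :: complex fls^'n^'n. invertible \<delta> \<and>
        span_over (*s) R V = {\<delta> *v c | c. \<forall>i. c $ i \<in> R} \<and>
        (\<exists>d F' R' (\<epsilon> :: complex fls^'n^'n). etale_nbhd F R d F' R' \<and>
           (\<forall>i j. \<epsilon> $ i $ j \<in> R') \<and> det \<epsilon> \<noteq> 0 \<and> inverse (det \<epsilon>) \<in> R' \<and>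
           (\<forall>e \<tau>. embedding_over F d F' e \<tau> \<longrightarrow>
              map_matrix (pull e) \<delta> ** map_matrix \<tau> \<epsilon> \<in> loop_pts G)))"

text \<open>
  A point of the Grassmannian is a torsor on the curve with a reduction over \<open>D\<close> to a trivialised
  torsor \<open>E\<close> of the integral Heisenberg group scheme.  As \<open>E\<close> is trivialised, the reduction
  amounts to a trivialisation of the torsor over \<open>D\<close>; \<open>E\<close> is then the group scheme itself.
\<close>

definition Gr_hat :: "complex fls set \<Rightarrow> (complex^'n^'n) set \<Rightarrow> (complex fls^'n) set set" where
  "Gr_hat F G = {V. torsor_module F G V}"

section \<open>Atiyah bundles\<close>

text \<open>
  Over the punctured disc the trivialisation splits the Atiyah algebra of \<open>P\<close>: the pair
  \<open>(f, M)\<close> is the invariant vector field which acts on sections of the associated bundle by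
  \<open>f d/dz + M\<close>.  It extends over the affine part if \<open>f d/dz\<close> does and the operator preserves \<open>V\<close>.
\<close>

definition apply_op :: "complex fls \<Rightarrow> complex fls^'n^'n \<Rightarrow> complex fls^'n \<Rightarrow> complex fls^'n" where
  "apply_op f M v = (\<chi> i. f * fls_deriv (v $ i)) + M *v v"

definition atiyah_P :: "complex fls set \<Rightarrow> (complex^'n^'n) set \<Rightarrow> (complex fls^'n) set \<Rightarrow>
    (complex fls \<times> (complex fls^'n^'n)) set" where
  "atiyah_P F G V = {(f, M). f \<in> vector_fields F \<and> M \<in> loop_lie G \<and> (\<forall>v\<in>V. apply_op f M v \<in> V)}"

definition ad_P :: "complex fls set \<Rightarrow> (complex^'n^'n) set \<Rightarrow> (complex fls^'n) set \<Rightarrow>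
    (complex fls^'n^'n) set" where
  "ad_P F G V = {M\<in>loop_lie G. \<forall>v\<in>V. M *v v \<in> V}"

text \<open>
  The \<open>N(H)\<close>-torsor \<open>Q\<close> attached to \<open>E\<close> becomes \<open>q N(H)\<close> on the cover, so the
  \<open>N(H)\<close>-invariant vector fields on \<open>Q\<close> are the operators \<open>D = f d/dz + M\<close> for which
  \<open>q\<^sup>-\<^sup>1 D q - f d/dz = q\<^sup>-\<^sup>1 (M q + f dq/dz)\<close> has values in the Lie algebra of \<open>H\<close>.
\<close>

definition atiyah_E :: "(complex^'n^'n) set \<Rightarrow> (complex^'n^'n) set \<Rightarrow> nat \<Rightarrow>
    complex fls^'n^'n \<Rightarrow> (complex fls \<times> (complex fls^'n^'n)) set" where
  "atiyah_E G H d q = {(f, M). M \<in> loop_lie G \<and>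
     matrix_inv q ** (map_matrix (pull d) M ** q + mat_scale (pull d f) (map_matrix (dz d) q))
       \<in> loop_lie H}"

definition A_stab :: "complex fls set \<Rightarrow> (complex^'n^'n) set \<Rightarrow> (complex^'n^'n) set \<Rightarrow> nat \<Rightarrow>
    complex fls^'n^'n \<Rightarrow> (complex fls^'n) set \<Rightarrow> (complex fls \<times> (complex fls^'n^'n)) set" where
  "A_stab F G H d q V = atiyah_E G H d q \<inter> atiyah_P F G V"

definition string_point :: "complex fls set \<Rightarrow> (complex^'n^'n) set \<Rightarrow> (complex^'n^'n) set \<Rightarrow>
    nat \<Rightarrow> complex fls^'n^'n \<Rightarrow> (complex fls^'n) set \<Rightarrow> bool" where
  "string_point F G H d q V \<longleftrightarrow> fst ` A_stab F G H d q V = vector_fields F"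

definition A0_stab :: "complex fls set \<Rightarrow> (complex^'n^'n) set \<Rightarrow> (complex^'n^'n) set \<Rightarrow> nat \<Rightarrow>
    complex fls^'n^'n \<Rightarrow> (complex fls^'n) set \<Rightarrow> (complex fls^'n^'n) set" where
  "A0_stab F G H d q V = heis_lie G H d q \<inter> ad_P F G V"

text \<open>
  Sections over an open set \<open>U\<close> of the sheaf associated with the module \<open>A0_stab\<close>.  Regular
  functions on \<open>U\<close> are flat over those on the affine part and \<open>A0_stab\<close> is torsion free, so the
  tensor product is the module generated by \<open>A0_stab\<close> inside Laurent series matrices.
\<close>

definition c_sections :: "complex fls set \<Rightarrow> (complex^'n^'n) set \<Rightarrow> (complex^'n^'n) set \<Rightarrow> nat \<Rightarrow>
    complex fls^'n^'n \<Rightarrow> (complex fls^'n) set \<Rightarrow> complex fls set set \<Rightarrow>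
    (complex fls^'n^'n) set" where
  "c_sections F G H d q V U = span_over mat_scale (regular_functions F U) (A0_stab F G H d q V)"

definition open_affine_part :: "complex fls set \<Rightarrow> complex fls set set \<Rightarrow> bool" where
  "open_affine_part F U \<longleftrightarrow> U \<subseteq> affine_part F \<and> U \<noteq> {} \<and> finite (affine_part F - U)"

end

theory Submission
  imports Defs
begin

text \<open>
  In genus zero the affine part has a coordinate \<open>t\<close> with a simple pole at infinity, its functions
  are the polynomials in \<open>t\<close>, and \<open>F\<close> is the field of fractions. At a string point \<open>d/dt\<close> lifts to
  an operator preserving both \<open>V\<close> and the Heisenberg algebra; its commutator with the module
  \<open>A0_stab\<close> is a connection. After conjugation by \<open>q\<close> it is \<open>d/dt\<close> acting on Laurent series with
  values in the abelian Lie algebra of \<open>H\<close>, so it lowers the pole order at infinity. Since \<open>V\<close> is a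
  discrete lattice, the connection is locally nilpotent, and a nonzero module would contain a
  nonzero horizontal element: a constant vector of the Lie algebra of \<open>H\<close> fixed by the monodromy,
  which does not exist in the elliptic case.
\<close>

text \<open>The gain per step is explicit: \<open>d/dt\<close> is \<open>(1/t') d/dz\<close>, where
  \<open>1/t'\<close> has a double zero at infinity and \<open>d/dz\<close> costs one order, so
  every commutator raises the order in \<open>z\<close> by one. Conjugation by \<open>q\<close>
  leaves a plain derivation because the remaining matrix part of the operator and the conjugated
  module lie in the same commutative Lie algebra. Two obstacles shape the work. The curve is given
  only through its valuation rings, so that both descriptions by \<open>t\<close> have to be proved:
  a pole at an affine point is produced by extending a ring to a valuation ring, and fractions in
  \<open>t\<close> are what gives the coordinates of \<open>V\<close> in a local frame a common
  denominator. Secondly, the monodromy is known only as a Laurent series solution of the polynomial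
  equations of a coset of \<open>H\<close>. Commutation is therefore extracted from linear
  equations, namely diagonality in a fixed basis; these pass to Laurent series points and to tangent
  vectors alike.\<close>

no_notation fps_nth (infixl "$" 75)

section \<open>Subalgebras and valuation rings\<close>

lemma subalg_const: "subalg R \<Longrightarrow> fls_const c \<in> R"
  by (auto simp: subalg_def)

lemma subalg_0: "subalg R \<Longrightarrow> 0 \<in> R"
  using subalg_const[of R 0] by simp

lemma subalg_1: "subalg R \<Longrightarrow> 1 \<in> R"
  using subalg_const[of R 1] by simp

lemma subalg_diff: "subalg R \<Longrightarrow> x \<in> R \<Longrightarrow> y \<in> R \<Longrightarrow> x - y \<in> R"
  by (auto simp: subalg_def)

lemma subalg_mult: "subalg R \<Longrightarrow> x \<in> R \<Longrightarrow> y \<in> R \<Longrightarrow> x * y \<in> R"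
  by (auto simp: subalg_def)

lemma subalg_minus: "subalg R \<Longrightarrow> x \<in> R \<Longrightarrow> - x \<in> R"
  using subalg_diff[of R 0 x] subalg_0 by simp

lemma subalg_add: "subalg R \<Longrightarrow> x \<in> R \<Longrightarrow> y \<in> R \<Longrightarrow> x + y \<in> R"
  using subalg_diff[of R x "- y"] subalg_minus by simp

lemma subalg_sum: "subalg R \<Longrightarrow> (\<And>i. i \<in> I \<Longrightarrow> f i \<in> R) \<Longrightarrow> sum f I \<in> R"
  by (induction I rule: infinite_finite_induct) (auto simp: subalg_0 subalg_add)

lemma subalg_power: "subalg R \<Longrightarrow> x \<in> R \<Longrightarrow> x ^ n \<in> R"
  by (induction n) (auto simp: subalg_1 subalg_mult)

section \<open>Polynomial expressions in one Laurent series\<close>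

definition evl :: "complex fls \<Rightarrow> complex poly \<Rightarrow> complex fls" where
  "evl x p = poly (map_poly fls_const p) x"

lemma evl_0 [simp]: "evl x 0 = 0"
  by (simp add: evl_def)

lemma evl_pCons [simp]: "evl x (pCons a p) = fls_const a + x * evl x p"
proof (cases "a = 0 \<and> p = 0")
  case False
  then have "map_poly fls_const (pCons a p) = pCons (fls_const a) (map_poly fls_const p)"
    by (intro map_poly_pCons) auto
  then show ?thesis by (simp add: evl_def)
qed simp

lemma evl_add: "evl x (p + r) = evl x p + evl x r"
proof (induction p r rule: poly_induct2)
  case (pCons a p b q)
  then show ?case by (simp add: algebra_simps flip: fls_plus_const)
qed simp

lemma evl_smult: "evl x (smult c p) = fls_const c * evl x p"
  by (induction p) (auto simp: algebra_simps)

lemma evl_mult: "evl x (p * r) = evl x p * evl x r"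
  by (induction p) (auto simp: algebra_simps evl_add evl_smult)

lemma evl_diff: "evl x (p - r) = evl x p - evl x r"
  using evl_add[of x "p - r" r] by simp

lemma evl_monom: "evl x (monom c n) = fls_const c * x ^ n"
  by (induction n) (auto simp: monom_0 monom_Suc mult_ac)

lemma evl_sum: "evl x (sum f I) = (\<Sum>i\<in>I. evl x (f i))"
  by (induction I rule: infinite_finite_induct) (auto simp: evl_add)

lemma evl_altdef: "degree p \<le> n \<Longrightarrow> evl x p = (\<Sum>i\<le>n. fls_const (coeff p i) * x ^ i)"
  by (subst poly_as_sum_of_monoms'[of p n, symmetric]) (simp_all add: evl_sum evl_monom)

lemma subalg_evl: "subalg R \<Longrightarrow> x \<in> R \<Longrightarrow> evl x p \<in> R"
  by (induction p) (auto simp: subalg_0 subalg_add subalg_mult subalg_const)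

lemma subalg_range_evl: "subalg (range (evl x))"
proof -
  have "fls_const c \<in> range (evl x)" for c
    using evl_pCons[of x c 0] by (metis add.right_neutral evl_0 mult_zero_right rangeI)
  then show ?thesis
    unfolding subalg_def by (auto simp flip: evl_diff evl_mult)
qed

lemma range_evl_self: "x \<in> range (evl x)"
proof -
  have "evl x [:0, 1:] = x" by simp
  then show ?thesis by (metis rangeI)
qed

text \<open>If \<open>x\<close> has a pole and \<open>p\<close> is nonzero, then
  \<open>x * evl x p\<close> has a pole, whose order is not changed by adding a constant; so the
  leading term is never cancelled. In particular such an \<open>x\<close> is transcendental over the
  constants.\<close>

lemma evl_subdegree:
  assumes "fls_subdegree x < 0" "p \<noteq> 0"
  shows "evl x p \<noteq> 0 \<and> fls_subdegree (evl x p) = int (degree p) * fls_subdegree x"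
  using assms(2)
proof (induction p)
  case (pCons a p)
  show ?case
  proof (cases "p = 0")
    case True
    then show ?thesis using pCons by auto
  next
    case False
    have nz: "x \<noteq> 0" using assms by auto
    have IH: "evl x p \<noteq> 0" "fls_subdegree (evl x p) = int (degree p) * fls_subdegree x"
      using pCons False by auto
    have sd: "fls_subdegree (x * evl x p) = int (degree (pCons a p)) * fls_subdegree x"
      using IH nz False by (simp add: algebra_simps)
    moreover have "\<dots> < 0" using assms(1) False by (simp add: mult_pos_neg)
    ultimately have neg: "fls_subdegree (x * evl x p) < fls_subdegree (fls_const a)" by simp
    then have eq: "fls_subdegree (fls_const a + x * evl x p) = fls_subdegree (x * evl x p)"
      by (intro fls_subdegree_add_eq2) (use IH nz in auto)
    then show ?thesis using sd neg by force
  qed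
qed simp

lemma evl_eq_0_iff:
  assumes "fls_subdegree x < 0"
  shows "evl x p = 0 \<longleftrightarrow> p = 0"
  using evl_subdegree[OF assms, of p] by auto

text \<open>
  A maximal subring in which \<open>y\<close> stays a non-unit is a valuation ring: otherwise \<open>y\<close> becomes
  a unit after adjoining \<open>z\<close> and after adjoining \<open>1/z\<close>, and the lower-degree of the two
  resulting expressions of \<open>1/y\<close> can be used to shorten the other one.
\<close>

lemma one_minus_mult_power:
  assumes "subalg S" "y \<in> S" "u \<in> S"
  shows "\<exists>b\<in>S. (1 - y * u) ^ k = 1 - y * b"
proof (induction k)
  case 0
  then show ?case using subalg_0[OF assms(1)] by auto
next
  case (Suc k)
  then obtain b where b: "b \<in> S" "(1 - y * u) ^ k = 1 - y * b" by auto
  have "(1 - y * u) ^ Suc k = 1 - y * (u + b - y * u * b)"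
    unfolding power_Suc b by (simp add: algebra_simps)
  then show ?case
    using assms b by (intro bexI[of _ "u + b - y * u * b"])
      (auto intro!: subalg_diff subalg_add subalg_mult)
qed

lemma shorten_expression:
  assumes S: "subalg S" "y \<in> S" "y \<noteq> 0" "inverse y \<notin> S"
    and unit: "\<And>u. u \<in> S \<Longrightarrow> inverse (1 - y * u) \<in> S"
    and z: "z \<noteq> 0"
    and a: "\<And>i. a i \<in> S" "inverse y = (\<Sum>i\<le>n. a i * z ^ i)"
    and b: "\<And>i. b i \<in> S" "inverse y = (\<Sum>i\<le>m. b i * inverse z ^ i)"
    and "m \<le> n"
  shows "\<exists>a' n'. n' < n \<and> (\<forall>i. a' i \<in> S) \<and> inverse y = (\<Sum>i\<le>n'. a' i * z ^ i)"
proof -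
  have "m > 0"
    using b S by (cases m) auto
  with \<open>m \<le> n\<close> have "n > 0" by simp
  define v where "v = inverse (1 - y * b 0)"
  have v: "v \<in> S" unfolding v_def using unit b by auto
  have nz: "1 - y * b 0 \<noteq> 0"
  proof
    assume "1 - y * b 0 = 0"
    then have "b 0 = inverse y" using S by (auto simp: field_simps)
    with b S show False by metis
  qed
  have "1 = y * (\<Sum>i\<le>m. b i * inverse z ^ i)"
    using b S by (metis right_inverse)
  also have "(\<Sum>i\<le>m. b i * inverse z ^ i) = b 0 + (\<Sum>i=1..m. b i * inverse z ^ i)"
    by (simp add: sum.atMost_shift sum.atLeast1_atMost_eq atMost_atLeast0 sum.atLeast_Suc_atMost)
  finally have "1 - y * b 0 = y * (\<Sum>i=1..m. b i * inverse z ^ i)"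
    by (simp add: algebra_simps)
  then have one: "1 = v * (y * (\<Sum>i=1..m. b i * inverse z ^ i))"
    using nz unfolding v_def by (metis left_inverse)
  \<comment> \<open>Multiplying the leading term \<open>a n * z ^ n\<close> by the expression of 1
    just found replaces it by terms of degree \<open>n - m\<close> to \<open>n - 1\<close>; here
    \<open>m \<le> n\<close> keeps the exponents nonnegative. The new coefficients are collected in
    \<open>c\<close>.\<close>
  define c where "c i = (if i \<in> {n-m..<n} then a n * v * y * b (n - i) else 0)" for i
  have "a n * z ^ n = a n * z ^ n * (v * (y * (\<Sum>i=1..m. b i * inverse z ^ i)))"
    using one by simp
  also have "\<dots> = (\<Sum>i=1..m. a n * v * y * b i * (z ^ n * inverse z ^ i))"
    by (simp add: sum_distrib_left sum_distrib_right mult_ac)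
  also have "\<dots> = (\<Sum>i=1..m. a n * v * y * b i * z ^ (n - i))"
    using z \<open>m \<le> n\<close> by (intro sum.cong) (auto simp: power_diff field_simps)
  also have "\<dots> = (\<Sum>i\<in>{n-m..<n}. c i * z ^ i)"
    using \<open>m \<le> n\<close>
    by (intro sum.reindex_bij_witness[of _ "\<lambda>i. n - i" "\<lambda>i. n - i"]) (auto simp: c_def)
  also have "\<dots> = (\<Sum>i\<le>n-1. c i * z ^ i)"
    using \<open>n > 0\<close> by (intro sum.mono_neutral_left) (auto simp: c_def)
  finally have last: "a n * z ^ n = (\<Sum>i\<le>n-1. c i * z ^ i)" .
  have "inverse y = (\<Sum>i\<le>n-1. a i * z ^ i) + a n * z ^ n"
    using a \<open>n > 0\<close> by (cases n) auto
  also have "\<dots> = (\<Sum>i\<le>n-1. (a i + c i) * z ^ i)"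
    unfolding last by (simp add: algebra_simps sum.distrib)
  finally have "inverse y = (\<Sum>i\<le>n-1. (a i + c i) * z ^ i)" .
  moreover have "a i + c i \<in> S" for i
    using a b v S by (auto simp: c_def subalg_0 intro!: subalg_add subalg_mult)
  ultimately show ?thesis using \<open>n > 0\<close>
    by (intro exI[of _ "\<lambda>i. a i + c i"] exI[of _ "n - 1"]) auto
qed

definition adjoin :: "complex fls set \<Rightarrow> complex fls \<Rightarrow> complex fls set" where
  "adjoin S z = {poly p z | p. \<forall>i. coeff p i \<in> S}"

lemma subalg_adjoin:
  assumes "subalg S"
  shows "subalg (adjoin S z)" "S \<subseteq> adjoin S z" "z \<in> adjoin S z"
proof -
  have const: "s \<in> adjoin S z" if "s \<in> S" for s
    unfolding adjoin_def using that subalg_0[OF assms]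
    by (intro CollectI exI[of _ "[:s:]"]) (auto simp: coeff_pCons split: nat.split)
  then show "S \<subseteq> adjoin S z" by auto
  show "z \<in> adjoin S z"
    unfolding adjoin_def using subalg_0[OF assms] subalg_1[OF assms]
    by (intro CollectI exI[of _ "[:0, 1:]"]) (auto simp: coeff_pCons split: nat.split)
  show "subalg (adjoin S z)"
    unfolding subalg_def
  proof (intro conjI ballI)
    show "range fls_const \<subseteq> adjoin S z"
      using const subalg_const[OF assms] by auto
    fix x y assume "x \<in> adjoin S z" "y \<in> adjoin S z"
    then obtain p r where p: "x = poly p z" "\<forall>i. coeff p i \<in> S"
      and r: "y = poly r z" "\<forall>i. coeff r i \<in> S"
      by (auto simp: adjoin_def)
    show "x - y \<in> adjoin S z"
      unfolding adjoin_def using p r subalg_diff[OF assms]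
      by (intro CollectI exI[of _ "p - r"]) auto
    show "x * y \<in> adjoin S z"
      unfolding adjoin_def using p r
      by (intro CollectI exI[of _ "p * r"])
        (auto simp: coeff_mult intro!: subalg_sum[OF assms] subalg_mult[OF assms])
  qed
qed

lemma adjoin_subset:
  assumes "subalg F" "S \<subseteq> F" "z \<in> F"
  shows "adjoin S z \<subseteq> F"
  using assms by (auto simp: adjoin_def poly_altdef intro!: subalg_sum subalg_mult subalg_power)

lemma adjoin_sum:
  assumes "subalg S" "x \<in> adjoin S z"
  obtains a n where "\<And>i. a i \<in> S" "x = (\<Sum>i\<le>n. a i * z ^ i)"
  using assms unfolding adjoin_def poly_altdef by blast

text \<open>Zorn's lemma is applied to the subalgebras of \<open>F\<close> that contain
  \<open>y\<close> but not \<open>inverse y\<close>. The polynomials in \<open>y\<close> are one of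
  them, since their subdegrees are at most 0 while \<open>inverse y\<close> has positive subdegree.
  The point obtained is one where \<open>y\<close> vanishes, so it differs from infinity, where
  \<open>y\<close> has a pole.\<close>

theorem valuation_ring_exists:
  assumes F: "subalg F" "\<And>x. x \<in> F \<Longrightarrow> inverse x \<in> F"
    and y: "y \<in> F" "fls_subdegree y < 0"
  obtains R where "R \<in> points F" "y \<in> R" "inverse y \<notin> R"
proof -
  have y0: "y \<noteq> 0" using y by auto
  define \<S> where "\<S> = {S. subalg S \<and> S \<subseteq> F \<and> y \<in> S \<and> inverse y \<notin> S}"
  have "range (evl y) \<in> \<S>"
  proof -
    have "inverse y \<noteq> evl y p" for p
    proof
      assume eq: "inverse y = evl y p"
      then have "p \<noteq> 0" using y0 by auto
      from evl_subdegree[OF y(2) this] have "fls_subdegree (evl y p) \<le> 0"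
        using y(2) by (simp add: mult_nonneg_nonpos)
      moreover have "fls_subdegree (inverse y) > 0"
        using y by (simp add: fls_inverse_subdegree)
      ultimately show False using eq by simp
    qed
    then show ?thesis
      unfolding \<S>_def using F y by (auto simp: subalg_range_evl range_evl_self subalg_evl)
  qed
  then have ne: "\<S> \<noteq> {}" by auto
  have chain: "\<Union>C \<in> \<S>" if C: "C \<noteq> {}" "subset.chain \<S> C" for C
  proof -
    have CS: "C \<subseteq> \<S>" using C by (auto simp: subset.chain_def)
    have "subalg (\<Union>C)"
      unfolding subalg_def
    proof (intro conjI ballI)
      obtain S where "S \<in> C" using C by auto
      then show "range fls_const \<subseteq> \<Union>C"
        using CS subalg_const[of S] by (auto simp: \<S>_def)
    next
      fix u v assume "u \<in> \<Union>C" "v \<in> \<Union>C"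
      then obtain S T where "S \<in> C" "T \<in> C" "u \<in> S" "v \<in> T" by auto
      moreover have "S \<subseteq> T \<or> T \<subseteq> S"
        using C \<open>S \<in> C\<close> \<open>T \<in> C\<close> by (auto simp: subset.chain_def)
      ultimately obtain U where U: "U \<in> C" "u \<in> U" "v \<in> U" by auto
      then have "subalg U" using CS by (auto simp: \<S>_def)
      with U show "u - v \<in> \<Union>C" "u * v \<in> \<Union>C"
        using subalg_diff subalg_mult by blast+
    qed
    then show ?thesis using C CS by (auto simp: \<S>_def)
  qed
  obtain S where S: "S \<in> \<S>" and max: "\<And>T. T \<in> \<S> \<Longrightarrow> S \<subseteq> T \<Longrightarrow> T = S"
    using subset_Zorn_nonempty[OF ne chain] by metis
  have Sa: "subalg S" "S \<subseteq> F" "y \<in> S" "inverse y \<notin> S" using S by (auto simp: \<S>_def)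
  have unit: "inverse (1 - y * u) \<in> S" if u: "u \<in> S" for u
  proof -
    define e where "e = inverse (1 - y * u)"
    have e1: "1 - y * u \<noteq> 0"
    proof
      assume "1 - y * u = 0"
      then have "u = inverse y" using y0 by (simp add: field_simps)
      with u Sa show False by simp
    qed
    have eF: "e \<in> F"
      unfolding e_def using Sa u F
      by (intro F subalg_diff subalg_mult subalg_1) auto
    have "inverse y \<notin> adjoin S e"
    proof
      assume "inverse y \<in> adjoin S e"
      then obtain a n where a: "\<And>i. a i \<in> S" "inverse y = (\<Sum>i\<le>n. a i * e ^ i)"
        using adjoin_sum[OF Sa(1)] by blast
      \<comment> \<open>Multiplication by \<open>(1 - y * u) ^ n\<close> clears the powers of
        \<open>e\<close>. As this power has the form \<open>1 - y * b\<close>, the product with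
        \<open>inverse y\<close> is \<open>inverse y - b\<close>, which forces
        \<open>inverse y\<close> into \<open>S\<close>.\<close>
      define s where "s = (\<Sum>i\<le>n. a i * (1 - y * u) ^ (n - i))"
      have sS: "s \<in> S" unfolding s_def using Sa u a
        by (intro subalg_sum subalg_mult subalg_power subalg_diff subalg_1) auto
      have "inverse y * (1 - y * u) ^ n = s"
        unfolding a s_def e_def sum_distrib_right using e1
        by (intro sum.cong) (auto simp: power_diff field_simps)
      moreover obtain b where b: "b \<in> S" "(1 - y * u) ^ n = 1 - y * b"
        using one_minus_mult_power[OF Sa(1,3) u] by blast
      ultimately have "inverse y = s + b" using y0 by (simp add: field_simps)
      then show False using Sa sS b subalg_add by metis
    qed
    then have "adjoin S e \<in> \<S>"
      using subalg_adjoin[OF Sa(1), of e] adjoin_subset[OF F(1) Sa(2) eF] Sa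
      by (auto simp: \<S>_def)
    from max[OF this] show ?thesis using subalg_adjoin[OF Sa(1), of e] by (auto simp: e_def)
  qed
  have val: "z \<in> S \<or> inverse z \<in> S" if z: "z \<in> F" for z
  proof (rule ccontr)
    assume "\<not> ?thesis"
    then have neg: "z \<notin> S" "inverse z \<notin> S" by auto
    then have z0: "z \<noteq> 0" using subalg_0 Sa by auto
    define P where "P z n \<longleftrightarrow> (\<exists>a. (\<forall>i. a i \<in> S) \<and> inverse y = (\<Sum>i\<le>n. a i * z ^ i))"
      for z and n :: nat
    have ex: "\<exists>n. P z n" if "z \<in> F" "z \<notin> S" for z
    proof -
      have "adjoin S z \<notin> \<S>"
        using max[of "adjoin S z"] subalg_adjoin[OF Sa(1), of z] that by auto
      then have "inverse y \<in> adjoin S z"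
        using subalg_adjoin[OF Sa(1), of z] adjoin_subset[OF F(1) Sa(2) that(1)] Sa
        by (auto simp: \<S>_def)
      then obtain a n where a: "\<And>i. a i \<in> S" "inverse y = (\<Sum>i\<le>n. a i * z ^ i)"
        using adjoin_sum[OF Sa(1)] by blast
      then show ?thesis unfolding P_def by blast
    qed
    have red: "\<exists>n'<n. P z n'" if "P z n" "P (inverse z) m" "m \<le> n" "z \<noteq> 0" for z n m
    proof -
      obtain a b where ab: "\<And>i. a i \<in> S" "inverse y = (\<Sum>i\<le>n. a i * z ^ i)"
         "\<And>i. b i \<in> S" "inverse y = (\<Sum>i\<le>m. b i * inverse z ^ i)"
        using \<open>P z n\<close> \<open>P (inverse z) m\<close> unfolding P_def by metis
      show ?thesis
        using shorten_expression[OF Sa(1,3) y0 Sa(4) unit \<open>z \<noteq> 0\<close> ab \<open>m \<le> n\<close>]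
        unfolding P_def by blast
    qed
    define n m where "n = (LEAST n. P z n)" and "m = (LEAST m. P (inverse z) m)"
    have n: "P z n" "\<And>k. k < n \<Longrightarrow> \<not> P z k"
      unfolding n_def using LeastI_ex[OF ex[OF z neg(1)]] by (auto dest: not_less_Least)
    have m: "P (inverse z) m" "\<And>k. k < m \<Longrightarrow> \<not> P (inverse z) k"
      unfolding m_def using LeastI_ex[OF ex[OF F(2)[OF z] neg(2)]] by (auto dest: not_less_Least)
    show False
    proof (cases "m \<le> n")
      case True
      then show False using red[of z n m] n m z0 by blast
    next
      case False
      then show False using red[of "inverse z" m n] n m z0 by force
    qed
  qed
  have "S \<in> points F"
    unfolding points_def using Sa val F(2)[OF y(1)] by auto
  then show ?thesis using that Sa by blast
qed

section \<open>Algebraic dependence in function fields\<close>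

lemma span_over_finite:
  assumes "finite B" "0 \<in> R" "\<And>s. sc 0 s = 0"
  shows "span_over sc R B = {\<Sum>s\<in>B. sc (a s) s | a. a ` B \<subseteq> R}"
proof (intro equalityI subsetI)
  fix v assume "v \<in> span_over sc R B"
  then obtain T a where T: "v = (\<Sum>s\<in>T. sc (a s) s)" "finite T" "T \<subseteq> B" "a ` T \<subseteq> R"
    by (auto simp: span_over_def)
  define a' where "a' s = (if s \<in> T then a s else 0)" for s
  have "v = (\<Sum>s\<in>B. sc (a' s) s)"
    unfolding T(1) using T assms by (intro sum.mono_neutral_cong_left) (auto simp: a'_def)
  moreover have "a' ` B \<subseteq> R" using T assms by (auto simp: a'_def)
  ultimately show "v \<in> {\<Sum>s\<in>B. sc (a s) s | a. a ` B \<subseteq> R}" by blast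
next
  fix v assume "v \<in> {\<Sum>s\<in>B. sc (a s) s | a. a ` B \<subseteq> R}"
  then obtain a where "v = (\<Sum>s\<in>B. sc (a s) s)" "a ` B \<subseteq> R" by blast
  with assms(1) show "v \<in> span_over sc R B" unfolding span_over_def by blast
qed

text \<open>Gaussian elimination, one pivot at a time, with all entries kept in the subfield
  \<open>K\<close>. The subfield is a set because the field of rational functions in an element is
  not a type of its own.\<close>

lemma homogeneous_system_solvable:
  fixes a :: "'i \<Rightarrow> 'j \<Rightarrow> 'a::field"
  assumes K: "0 \<in> K" "1 \<in> K" "\<And>x y. x \<in> K \<Longrightarrow> y \<in> K \<Longrightarrow> x - y \<in> K"
      "\<And>x y. x \<in> K \<Longrightarrow> y \<in> K \<Longrightarrow> x * y \<in> K" "\<And>x. x \<in> K \<Longrightarrow> inverse x \<in> K"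
    and "finite I" "finite J" "card I < card J"
    and "\<And>i j. i \<in> I \<Longrightarrow> j \<in> J \<Longrightarrow> a i j \<in> K"
  shows "\<exists>c. (\<forall>j\<in>J. c j \<in> K) \<and> (\<exists>j\<in>J. c j \<noteq> 0) \<and> (\<forall>i\<in>I. (\<Sum>j\<in>J. a i j * c j) = 0)"
  using assms(6-)
proof (induction I arbitrary: J a rule: finite_induct)
  case empty
  then have "J \<noteq> {}" by auto
  then show ?case using K(2) by (intro exI[of _ "\<lambda>_. 1"]) auto
next
  case (insert i0 I)
  show ?case
  proof (cases "\<forall>j\<in>J. a i0 j = 0")
    case True
    have "card I < card J" using insert.prems insert.hyps by simp
    then obtain c where "\<forall>j\<in>J. c j \<in> K" "\<exists>j\<in>J. c j \<noteq> 0" "\<forall>i\<in>I. (\<Sum>j\<in>J. a i j * c j) = 0"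
      using insert.IH[of J a] insert.prems by auto
    with True show ?thesis by (intro exI[of _ c]) auto
  next
    case False
    then obtain j0 where j0: "j0 \<in> J" "a i0 j0 \<noteq> 0" by auto
    define J' where "J' = J - {j0}"
    define a' where "a' i j = a i j - a i j0 * (inverse (a i0 j0) * a i0 j)" for i j
    have J': "finite J'" "card I < card J'" "J = insert j0 J'" "j0 \<notin> J'"
      using insert.prems insert.hyps j0 by (auto simp: J'_def)
    have Kneg: "- x \<in> K" if "x \<in> K" for x using K(1,3) that by (metis diff_0)
    have Ksum: "sum f S \<in> K" if "\<And>s. s \<in> S \<Longrightarrow> f s \<in> K" for f and S :: "'j set"
      using that
    proof (induction S rule: infinite_finite_induct)
      case (insert x S)
      then have "f x - (- sum f S) \<in> K" by (intro K(3) Kneg) auto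
      then show ?case using insert.hyps by simp
    qed (use K in auto)
    have "a' i j \<in> K" if "i \<in> I" "j \<in> J'" for i j
      unfolding a'_def using insert.prems(3) that j0 J' by (intro K) auto
    then obtain c where c: "\<forall>j\<in>J'. c j \<in> K" "\<exists>j\<in>J'. c j \<noteq> 0"
        "\<forall>i\<in>I. (\<Sum>j\<in>J'. a' i j * c j) = 0"
      using insert.IH[of J' a'] J' by auto
    \<comment> \<open>The value of the eliminated unknown \<open>j0\<close> that the pivot equation
      \<open>i0\<close> forces.\<close>
    define e where "e = - (inverse (a i0 j0) * (\<Sum>j\<in>J'. a i0 j * c j))"
    define c' where "c' = c(j0 := e)"
    have eK: "e \<in> K" unfolding e_def
      using insert.prems(3) j0 J' c by (intro Kneg K Ksum) auto
    have sum_eq: "(\<Sum>j\<in>J. a i j * c' j) = a i j0 * e + (\<Sum>j\<in>J'. a i j * c j)" for i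
    proof -
      have "(\<Sum>j\<in>J'. a i j * c' j) = (\<Sum>j\<in>J'. a i j * c j)"
        using J' by (intro sum.cong) (auto simp: c'_def)
      then show ?thesis unfolding J'(3) using J' by (simp add: c'_def)
    qed
    have "(\<Sum>j\<in>J. a i j * c' j) = (\<Sum>j\<in>J'. a' i j * c j)" for i
      unfolding sum_eq
      by (simp add: a'_def e_def algebra_simps sum_subtractf sum_distrib_left sum_distrib_right)
    moreover have "(\<Sum>j\<in>J. a i0 j * c' j) = 0"
      unfolding sum_eq using j0 by (simp add: e_def)
    moreover have "\<exists>j\<in>J. c' j \<noteq> 0" using c(2) J'(3,4) by (auto simp: c'_def)
    ultimately show ?thesis using c eK J' by (intro exI[of _ c']) (auto simp: c'_def)
  qed
qed

section \<open>The field of rational functions in one element\<close>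

lemma rational_inI: "evl t p / evl t r \<in> rational_in t"
  by (auto simp: rational_in_def evl_def)

lemma rational_inE:
  assumes "x \<in> rational_in t"
  obtains p r where "evl t r \<noteq> 0" "x = evl t p / evl t r"
proof -
  obtain p r where x: "x = evl t p / evl t r"
    using assms by (auto simp: rational_in_def evl_def)
  show ?thesis
  proof (cases "evl t r = 0")
    case True
    then show ?thesis using that[of 1 0] x by (simp add: one_pCons)
  qed (use that x in auto)
qed

lemma evl_rational_in: "evl t p \<in> rational_in t"
  using rational_inI[of t p 1] by (simp add: one_pCons)

lemma subalg_rational_in: "subalg (rational_in t)"
  unfolding subalg_def
proof (intro conjI ballI)
  show "range fls_const \<subseteq> rational_in t"
    using evl_rational_in[of t "[:c:]" for c] by auto
  fix x y assume "x \<in> rational_in t" "y \<in> rational_in t"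
  then obtain p r p' r' where *: "evl t r \<noteq> 0" "x = evl t p / evl t r"
      "evl t r' \<noteq> 0" "y = evl t p' / evl t r'"
    by (elim rational_inE) blast
  have "x - y = evl t (p * r' - p' * r) / evl t (r * r')"
    using *(1,3) unfolding *(2,4) by (simp add: evl_diff evl_mult field_simps)
  then show "x - y \<in> rational_in t" using rational_inI by simp
  have "x * y = evl t (p * p') / evl t (r * r')"
    using * by (simp add: evl_mult)
  then show "x * y \<in> rational_in t" using rational_inI by simp
qed

lemma inverse_rational_in: "x \<in> rational_in t \<Longrightarrow> inverse x \<in> rational_in t"
  by (elim rational_inE) (metis inverse_divide rational_inI)

lemma rational_in_mono:
  assumes "s \<in> rational_in t"
  shows "rational_in s \<subseteq> rational_in t"
proof
  fix x assume "x \<in> rational_in s"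
  then obtain p r where "x = evl s p / evl s r" by (elim rational_inE)
  then show "x \<in> rational_in t"
    using subalg_evl[OF subalg_rational_in assms] inverse_rational_in subalg_mult[OF subalg_rational_in]
    by (simp add: divide_inverse)
qed

lemma clear_denominators:
  assumes "finite J" "\<And>j. j \<in> J \<Longrightarrow> k j \<in> rational_in t"
  obtains D s where "evl t D \<noteq> 0" "\<And>j. j \<in> J \<Longrightarrow> evl t D * k j = evl t (s j)"
proof -
  have "\<exists>D s. evl t D \<noteq> 0 \<and> (\<forall>j\<in>J. evl t D * k j = evl t (s j))"
    using assms
  proof (induction J rule: finite_induct)
    case empty
    then show ?case by (intro exI[of _ 1]) (auto simp: one_pCons)
  next
    case (insert i J)
    then obtain D s where D: "evl t D \<noteq> 0" "\<forall>j\<in>J. evl t D * k j = evl t (s j)" by auto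
    obtain p r where p: "evl t r \<noteq> 0" "k i = evl t p / evl t r"
      using insert.prems[of i] by (auto elim: rational_inE)
    define s' where "s' j = (if j = i then D * p else r * s j)" for j
    have "evl t (D * r) * k j = evl t (s' j)" if "j \<in> insert i J" for j
      using that D p insert.hyps by (auto simp: s'_def evl_mult)
    then show ?case using D p by (intro exI[of _ "D * r"] exI[of _ s']) (auto simp: evl_mult)
  qed
  then show ?thesis using that by blast
qed

text \<open>The \<open>card B + 1\<close> powers of \<open>x\<close> from 0 to \<open>card B\<close>
  have coordinates with respect to the \<open>card B\<close> generators, so a linear relation
  between them is a solution of a system with more unknowns than equations.\<close>

lemma algebraic_dependence:
  assumes F: "F = span_over (*) (rational_in t0) B" "finite B" "subalg F" and x: "x \<in> F"
  obtains k :: "nat \<Rightarrow> complex fls" and n where "\<And>i. k i \<in> rational_in t0" "\<exists>i\<le>n. k i \<noteq> 0"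
    "(\<Sum>i\<le>n. k i * x ^ i) = 0"
proof -
  let ?K = "rational_in t0"
  note K = subalg_rational_in[of t0]
  have "\<exists>a. x ^ i = (\<Sum>b\<in>B. a b * b) \<and> a ` B \<subseteq> ?K" for i
    using subalg_power[OF F(3) x, of i] F(2) K
    unfolding F(1) by (subst (asm) span_over_finite) (auto simp: subalg_0)
  then obtain a where a: "\<And>i. x ^ i = (\<Sum>b\<in>B. a i b * b)" "\<And>i. a i ` B \<subseteq> ?K" by metis
  obtain c where c: "\<forall>j\<in>{..card B}. c j \<in> ?K" "\<exists>j\<in>{..card B}. c j \<noteq> 0"
      "\<forall>b\<in>B. (\<Sum>j\<in>{..card B}. a j b * c j) = 0"
    using homogeneous_system_solvable[of ?K B "{..card B}" "\<lambda>b j. a j b"] K F(2) a(2)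
      inverse_rational_in subalg_0 subalg_1 subalg_diff subalg_mult by (auto simp: image_subset_iff)
  have "(\<Sum>i\<le>card B. c i * x ^ i) = (\<Sum>i\<le>card B. \<Sum>b\<in>B. a i b * c i * b)"
    unfolding a(1) by (simp add: sum_distrib_left mult_ac)
  also have "\<dots> = (\<Sum>b\<in>B. (\<Sum>i\<le>card B. a i b * c i) * b)"
    by (subst sum.swap) (simp add: sum_distrib_right)
  also have "\<dots> = 0" using c by simp
  finally have "(\<Sum>i\<le>card B. c i * x ^ i) = 0" .
  \<comment> \<open>Coefficients are set to 0 beyond \<open>card B\<close>, since \<open>k i\<close>
    is to be rational for every \<open>i\<close>.\<close>
  then have "(\<Sum>i\<le>card B. (if i \<le> card B then c i else 0) * x ^ i) = 0" by simp
  then show ?thesis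
    using c subalg_0[OF K] by (intro that[of "\<lambda>i. if i \<le> card B then c i else 0" "card B"]) auto
qed

text \<open>The product of \<open>y\<close> with the leading coefficient is integral over
  \<open>R\<close>. Were it outside \<open>R\<close>, its inverse and hence
  \<open>e = inverse y\<close> would lie in \<open>R\<close>, and the relation multiplied by
  \<open>e ^ (J - 1)\<close> would express \<open>s J * y\<close> by elements of
  \<open>R\<close>.\<close>

lemma valuation_ring_integral:
  assumes R: "subalg R" "s J * y \<in> R \<or> inverse (s J * y) \<in> R"
    and s: "\<And>j. s j \<in> R" and rel: "(\<Sum>j\<le>J. s j * y ^ j) = 0" and "J > 0"
  shows "s J * y \<in> R"
proof (rule ccontr)
  assume neg: "s J * y \<notin> R"
  then have nz: "s J \<noteq> 0" "y \<noteq> 0" using subalg_0[OF R(1)] by auto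
  define e where "e = s J * inverse (s J * y)"
  have e: "e \<in> R" "e = inverse y"
    using R neg s nz by (auto simp: e_def intro!: subalg_mult)
  have "0 = (\<Sum>j\<le>J. s j * y ^ j) * e ^ (J - 1)" using rel by simp
  also have "\<dots> = (\<Sum>j<J. s j * y ^ j) * e ^ (J - 1) + s J * y ^ J * e ^ (J - 1)"
    by (simp add: lessThan_Suc_atMost[symmetric] algebra_simps)
  also have "s J * y ^ J * e ^ (J - 1) = s J * y"
    using \<open>J > 0\<close> nz by (cases J) (auto simp: e field_simps)
  also have "(\<Sum>j<J. s j * y ^ j) * e ^ (J - 1) = (\<Sum>j<J. s j * e ^ (J - 1 - j))"
    unfolding sum_distrib_right using nz
    by (intro sum.cong) (auto simp: e power_diff field_simps)
  finally have "s J * y = - (\<Sum>j<J. s j * e ^ (J - 1 - j))" by (simp add: eq_neg_iff_add_eq_0 add.commute)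
  moreover have "\<dots> \<in> R" using R s e by (intro subalg_minus subalg_sum subalg_mult subalg_power)
  ultimately show False using neg by simp
qed

section \<open>The affine part of a curve of genus zero\<close>

lemma subalg_regular_functions:
  assumes "subalg F" "U \<subseteq> points F"
  shows "subalg (regular_functions F U)"
proof -
  have R: "subalg R" if "R \<in> U" for R
    using subsetD[OF assms(2) that] by (simp add: points_def)
  show ?thesis
    unfolding subalg_def regular_functions_def
    using subalg_const[OF assms(1)] subalg_diff[OF assms(1)] subalg_mult[OF assms(1)]
      subalg_const[OF R] subalg_diff[OF R] subalg_mult[OF R]
    by (intro conjI ballI subsetI) auto
qed

lemma affine_points: "affine_part F \<subseteq> points F"
  by (auto simp: affine_part_def)

lemma pointed_curveD:
  assumes "pointed_curve F"
  shows "subalg F" "\<And>x. x \<in> F \<Longrightarrow> inverse x \<in> F"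
  using assms by (auto simp: pointed_curve_def function_field_def)

lemma infinity_pt_in_points:
  assumes "pointed_curve F"
  shows "infinity_pt F \<in> points F"
proof -
  note F = pointed_curveD[OF assms]
  obtain s where s: "s \<in> F" "fls_subdegree s = 1" using assms by (auto simp: pointed_curve_def)
  have "subalg (infinity_pt F)"
    unfolding subalg_def
  proof (intro conjI ballI)
    show "range fls_const \<subseteq> infinity_pt F"
      using subalg_const[OF F(1)] by (auto simp: infinity_pt_def)
    fix x y assume xy: "x \<in> infinity_pt F" "y \<in> infinity_pt F"
    show "x * y \<in> infinity_pt F"
      using xy F(1) by (auto simp: infinity_pt_def subalg_mult intro!: fls_mult_subdegree_ge_0)
    have "fls_subdegree (x - y) \<ge> 0"
    proof (cases "x - y = 0")
      case False
      then show ?thesis using xy fls_subdegree_minus[of x y] by (auto simp: infinity_pt_def)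
    qed auto
    then show "x - y \<in> infinity_pt F"
      using xy F(1) by (auto simp: infinity_pt_def subalg_diff)
  qed
  moreover have "inverse s \<in> F - infinity_pt F"
    using s F(2)[OF s(1)] by (auto simp: infinity_pt_def fls_inverse_subdegree)
  moreover have "x \<in> infinity_pt F \<or> inverse x \<in> infinity_pt F" if "x \<in> F" for x
    using that F(2)[OF that] by (auto simp: infinity_pt_def fls_inverse_subdegree)
  moreover have "infinity_pt F \<subseteq> F" by (auto simp: infinity_pt_def)
  ultimately show ?thesis unfolding points_def by blast
qed

text \<open>In genus zero every family of principal parts comes from a function. The family
  prescribed here is a simple pole \<open>inverse s\<close> at infinity and nothing
  elsewhere.\<close>

lemma affine_coordinate_exists:
  assumes "pointed_curve F" "has_genus F 0"
  obtains t where "t \<in> regular_functions F (affine_part F)" "fls_subdegree t = -1"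
proof -
  note F = pointed_curveD[OF assms(1)]
  obtain s where s: "s \<in> F" "fls_subdegree s = 1" using assms by (auto simp: pointed_curve_def)
  define r where "r R = (if R = infinity_pt F then inverse s else 0)" for R
  have "repartition F r"
    unfolding repartition_def
  proof
    show "\<forall>R\<in>points F. r R \<in> F" using F(2)[OF s(1)] subalg_0[OF F(1)] by (auto simp: r_def)
    have "{R \<in> points F. r R \<notin> R} \<subseteq> {infinity_pt F}"
      by (auto simp: r_def points_def subalg_0)
    then show "finite {R \<in> points F. r R \<notin> R}" by (rule finite_subset) simp
  qed
  then obtain f where f: "f \<in> F" "\<And>R. R \<in> points F \<Longrightarrow> r R - f \<in> R"
  proof -
    from assms(2) obtain b :: "nat \<Rightarrow> complex fls set \<Rightarrow> complex fls" where
      b: "\<forall>r. repartition F r \<longrightarrow> (\<exists>!c :: nat \<Rightarrow> complex. (\<forall>i\<ge>0. c i = 0) \<and>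
         (\<exists>f\<in>F. \<forall>R\<in>points F. r R - (\<Sum>i<0. fls_const (c i) * b i R) - f \<in> R))"
      unfolding has_genus_def by (elim exE conjE) (rule that)
    from b[rule_format, OF \<open>repartition F r\<close>, THEN ex1_implies_ex]
    have "\<exists>f\<in>F. \<forall>R\<in>points F. r R - f \<in> R" by (elim exE conjE) simp
    with that show ?thesis by blast
  qed
  have "inverse s - f \<in> infinity_pt F"
    using f(2)[OF infinity_pt_in_points[OF assms(1)]] by (simp add: r_def)
  then have ge: "fls_subdegree (inverse s - f) \<ge> 0" by (simp add: infinity_pt_def)
  have sd: "fls_subdegree (inverse s) = -1" "inverse s \<noteq> 0"
    using s by (auto simp: fls_inverse_subdegree)
  have "fls_subdegree (inverse s - (inverse s - f)) = -1"
    using fls_subdegree_diff_eq1[of "inverse s" "inverse s - f"] sd ge by simp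
  then have "fls_subdegree f = -1" by simp
  moreover have "f \<in> R" if "R \<in> affine_part F" for R
  proof -
    have "- f \<in> R" "subalg R"
      using f(2)[of R] that by (auto simp: r_def affine_part_def points_def)
    then show ?thesis using subalg_minus[of R "- f"] by simp
  qed
  ultimately show ?thesis using that f by (auto simp: regular_functions_def)
qed

text \<open>If \<open>x\<close> were nonzero, \<open>inverse x\<close> would have a pole at infinity
  and hence a zero at some other point. There \<open>x\<close> has a pole, against its regularity on
  the affine part.\<close>

lemma global_function_vanishing_at_infinity:
  assumes "pointed_curve F" "x \<in> regular_functions F (affine_part F)" "\<And>i. i \<le> 0 \<Longrightarrow> fls_nth x i = 0"
  shows "x = 0"
proof (rule ccontr)
  assume nz: "x \<noteq> 0"
  note F = pointed_curveD[OF assms(1)]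
  have x: "x \<in> F" using assms by (auto simp: regular_functions_def)
  have "fls_subdegree x > 0"
    using assms(3)[of "fls_subdegree x"] nz nth_fls_subdegree_nonzero by force
  then have "fls_subdegree (inverse x) < 0" by (simp add: fls_inverse_subdegree)
  then obtain R where R: "R \<in> points F" "inverse x \<in> R" "inverse (inverse x) \<notin> R"
    using valuation_ring_exists[OF F] F(2)[OF x] by blast
  have "x \<in> infinity_pt F" using x \<open>fls_subdegree x > 0\<close> by (auto simp: infinity_pt_def)
  then have "R \<in> affine_part F" using R by (auto simp: affine_part_def)
  then have "x \<in> R" using assms(2) by (auto simp: regular_functions_def)
  then show False using R by simp
qed

text \<open>As the pole of \<open>t\<close> is simple, its powers realise every pole order, and
  subtracting a multiple of a power lowers the pole. A function without a pole equals its value at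
  infinity, because the difference vanishes there.\<close>

lemma regular_functions_affine_part:
  assumes "pointed_curve F" "t \<in> regular_functions F (affine_part F)" "fls_subdegree t = -1"
  shows "regular_functions F (affine_part F) = range (evl t)"
proof
  let ?A = "regular_functions F (affine_part F)"
  have A: "subalg ?A"
    by (intro subalg_regular_functions pointed_curveD assms affine_points)
  show "range (evl t) \<subseteq> ?A" using subalg_evl[OF A assms(2)] by auto
  have "x \<in> range (evl t)" if "x \<in> ?A" "\<And>i. i < - int n \<Longrightarrow> fls_nth x i = 0" for x n
    using that
  proof (induction n arbitrary: x)
    case 0
    have "x - fls_const (fls_nth x 0) = 0"
      by (rule global_function_vanishing_at_infinity[OF assms(1)])
        (use 0 A in \<open>auto simp: subalg_diff subalg_const\<close>)
    then have "x = evl t [:fls_nth x 0:]" by simp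
    then show ?case by blast
  next
    case (Suc n)
    have t0: "t \<noteq> 0" using assms(3) by auto
    define k where "k = - int (Suc n)"
    have sd: "fls_subdegree (t ^ Suc n) = k"
      using assms(3) by (simp add: fls_subdegree_pow k_def del: power_Suc)
    have nz: "fls_nth (t ^ Suc n) k \<noteq> 0"
      using nth_fls_subdegree_nonzero[of "t ^ Suc n", unfolded sd] t0 by (simp del: power_Suc)
    define c where "c = fls_nth x k / fls_nth (t ^ Suc n) k"
    define y where "y = x - fls_const c * t ^ Suc n"
    have "y \<in> ?A" unfolding y_def
      using Suc A assms(2) by (intro subalg_diff subalg_mult subalg_const subalg_power) auto
    moreover have "fls_nth y i = 0" if "i < - int n" for i
    proof (cases "i = k")
      case True
      then show ?thesis using nz by (simp add: y_def c_def del: power_Suc)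
    next
      case False
      then have "i < k" using that by (simp add: k_def)
      then show ?thesis using Suc.prems(2)[of i] sd by (simp add: y_def k_def del: power_Suc)
    qed
    ultimately obtain p where "y = evl t p" using Suc.IH by blast
    then have "x = evl t (p + monom c (Suc n))" by (simp add: y_def evl_add evl_monom algebra_simps del: power_Suc)
    then show ?case by blast
  qed
  note main = this
  show "?A \<subseteq> range (evl t)"
  proof
    fix x assume x: "x \<in> ?A"
    have "fls_nth x i = 0" if "i < - int (nat (- fls_subdegree x))" for i
      using that by (intro fls_eq0_below_subdegree) linarith
    with x show "x \<in> range (evl t)" by (rule main)
  qed
qed

text \<open>The leading coefficient times \<open>y\<close> is integral over the polynomials in
  \<open>t\<close>. It therefore lies in every valuation ring of the affine part and is itself a
  polynomial in \<open>t\<close>.\<close>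

lemma algebraic_imp_fraction:
  assumes C: "pointed_curve F" and t: "t \<in> regular_functions F (affine_part F)" "fls_subdegree t = -1"
    and y: "y \<in> F" and s: "s j0 \<noteq> 0" "(\<Sum>j\<le>J0. evl t (s j) * y ^ j) = 0" "j0 \<le> J0"
  obtains g p where "g \<noteq> 0" "evl t g * y = evl t p"
proof -
  \<comment> \<open>The true degree of the relation, since \<open>s J0\<close> may vanish.\<close>
  define J where "J = Max {j. j \<le> J0 \<and> s j \<noteq> 0}"
  have fin: "finite {j. j \<le> J0 \<and> s j \<noteq> 0}" by simp
  have J: "J \<le> J0" "s J \<noteq> 0"
    using Max_in[OF fin, folded J_def] s by auto
  have top: "s j = 0" if "J < j" "j \<le> J0" for j
  proof (rule ccontr)
    assume "s j \<noteq> 0"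
    then have "j \<le> J" unfolding J_def using that by (intro Max_ge) auto
    then show False using that by simp
  qed
  have rel: "(\<Sum>j\<le>J. evl t (s j) * y ^ j) = 0"
  proof -
    have "(\<Sum>j\<le>J. evl t (s j) * y ^ j) = (\<Sum>j\<le>J0. evl t (s j) * y ^ j)"
      using J top by (intro sum.mono_neutral_left) auto
    then show ?thesis using s(2) by simp
  qed
  have "J > 0"
  proof (rule ccontr)
    assume "\<not> J > 0"
    then have "evl t (s J) = 0" using rel by simp
    then show False using J evl_eq_0_iff[of t] t by simp
  qed
  have "evl t (s J) * y \<in> regular_functions F (affine_part F)"
    unfolding regular_functions_def
  proof (intro CollectI conjI ballI)
    note F = pointed_curveD[OF C]
    show FF: "evl t (s J) * y \<in> F"
      using F y t by (intro subalg_mult subalg_evl) (auto simp: regular_functions_def)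
    fix R assume R: "R \<in> affine_part F"
    then have "subalg R" "t \<in> R"
      using t by (auto simp: affine_part_def points_def regular_functions_def)
    moreover have "evl t (s J) * y \<in> R \<or> inverse (evl t (s J) * y) \<in> R"
      using R FF by (auto simp: affine_part_def points_def)
    ultimately show "evl t (s J) * y \<in> R"
      using valuation_ring_integral[of R "\<lambda>j. evl t (s j)" J y] rel \<open>J > 0\<close>
      by (auto simp: subalg_evl)
  qed
  then obtain p where "evl t (s J) * y = evl t p"
    using regular_functions_affine_part[OF C t] by auto
  then show ?thesis using that J by blast
qed

text \<open>The definition of \<open>F\<close> provides finiteness only over the rational functions
  in some \<open>t0\<close>, so an exchange is made. The relation satisfied by \<open>t\<close> over
  \<open>t0\<close> is reread as one for \<open>t0\<close> over the polynomials in \<open>t\<close>;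
  this makes \<open>t0\<close> a fraction in \<open>t\<close>, and every \<open>y\<close> becomes
  algebraic over the fractions in \<open>t\<close>.\<close>

theorem function_field_fraction:
  assumes C: "pointed_curve F" and t: "t \<in> regular_functions F (affine_part F)" "fls_subdegree t = -1"
    and y: "y \<in> F"
  obtains g p where "g \<noteq> 0" "evl t g * y = evl t p"
proof -
  note F = pointed_curveD[OF C]
  have tF: "t \<in> F" using t by (auto simp: regular_functions_def)
  have neg: "fls_subdegree t < 0" using t by simp
  obtain t0 B where t0: "t0 \<in> F" "finite B" "F = span_over (*) (rational_in t0) B"
    using C unfolding pointed_curve_def function_field_def by blast
  obtain k n where k: "\<And>i. k i \<in> rational_in t0" "\<exists>i\<le>n. k i \<noteq> 0" "(\<Sum>i\<le>n. k i * t ^ i) = 0"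
    using algebraic_dependence[OF t0(3,2) F(1) tF] by metis
  obtain D P where P: "evl t0 D \<noteq> 0" "\<And>i. i \<in> {..n} \<Longrightarrow> evl t0 D * k i = evl t0 (P i)"
    using clear_denominators[of "{..n}" k t0] k(1) by blast
  obtain i0 where i0: "i0 \<le> n" "k i0 \<noteq> 0" using k(2) by auto
  then have "P i0 \<noteq> 0" using P(2)[of i0] P(1) by auto
  then obtain j0 where j0: "coeff (P i0) j0 \<noteq> 0" by (auto simp: poly_eq_iff)
  define N where "N = Max ((\<lambda>i. degree (P i)) ` {..n})"
  have N: "degree (P i) \<le> N" if "i \<le> n" for i
    unfolding N_def using that by (intro Max_ge) auto
  \<comment> \<open>The relation sorted by powers of \<open>t0\<close>: \<open>s j\<close> is the
    polynomial in \<open>t\<close> that multiplies \<open>t0 ^ j\<close>. It is nonzero at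
    \<open>j0\<close>, where its coefficient of index \<open>i0\<close> is a nonzero coefficient of
    \<open>P i0\<close>.\<close>
  define s where "s j = (\<Sum>i\<le>n. monom (coeff (P i) j) i)" for j
  have "coeff (s j0) i0 = coeff (P i0) j0"
    unfolding s_def using i0 by (simp add: coeff_sum coeff_monom)
  then have s0: "s j0 \<noteq> 0" using j0 by auto
  have j0N: "j0 \<le> N"
    using N[OF i0(1)] j0 le_degree[of "P i0" j0] by linarith
  have "(\<Sum>j\<le>N. evl t (s j) * t0 ^ j) = (\<Sum>j\<le>N. \<Sum>i\<le>n. fls_const (coeff (P i) j) * t0 ^ j * t ^ i)"
    by (simp add: s_def evl_sum evl_monom sum_distrib_left sum_distrib_right mult_ac)
  also have "\<dots> = (\<Sum>i\<le>n. evl t0 (P i) * t ^ i)"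
    by (subst sum.swap) (simp add: evl_altdef[OF N] sum_distrib_right)
  also have "\<dots> = evl t0 D * (\<Sum>i\<le>n. k i * t ^ i)"
    using P(2) by (simp add: sum_distrib_left mult.assoc[symmetric])
  finally have "(\<Sum>j\<le>N. evl t (s j) * t0 ^ j) = 0" using k(3) by simp
  then obtain g p where g: "g \<noteq> 0" "evl t g * t0 = evl t p"
    using algebraic_imp_fraction[OF C t t0(1), of s j0 N] s0 j0N by blast
  then have "t0 = evl t p / evl t g"
    using evl_eq_0_iff[OF neg, of g] by (simp add: field_simps)
  then have sub: "rational_in t0 \<subseteq> rational_in t"
    by (intro rational_in_mono) (simp add: rational_inI)
  obtain k' n' where k': "\<And>i. k' i \<in> rational_in t0" "\<exists>i\<le>n'. k' i \<noteq> 0" "(\<Sum>i\<le>n'. k' i * y ^ i) = 0"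
    using algebraic_dependence[OF t0(3,2) F(1) y] by metis
  obtain D' s' where s': "evl t D' \<noteq> 0" "\<And>i. i \<in> {..n'} \<Longrightarrow> evl t D' * k' i = evl t (s' i)"
    using clear_denominators[of "{..n'}" k' t] k'(1) sub by blast
  obtain i1 where i1: "i1 \<le> n'" "k' i1 \<noteq> 0" using k'(2) by auto
  then have "s' i1 \<noteq> 0" using s'(2)[of i1] s'(1) by auto
  moreover have "(\<Sum>i\<le>n'. evl t (s' i) * y ^ i) = evl t D' * (\<Sum>i\<le>n'. k' i * y ^ i)"
    using s'(2) by (simp add: sum_distrib_left mult.assoc[symmetric])
  ultimately show ?thesis
    using algebraic_imp_fraction[OF C t y, of s' i1 n'] i1 k'(3) that by auto
qed

section \<open>Matrices over a ring with a derivation\<close>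

lemma matrix_inv_mult:
  fixes A :: "'a::semiring_1^'n^'n"
  assumes "invertible A"
  shows "A ** matrix_inv A = mat 1" "matrix_inv A ** A = mat 1"
  using someI_ex[OF assms[unfolded invertible_def]] unfolding matrix_inv_def by auto

lemma matrix_add_rdistrib: "(A + B) ** C = A ** C + B ** C"
  for A B :: "'a::semiring_1^'n^'m"
  by (vector matrix_matrix_mult_def sum.distrib[symmetric] distrib_right)

lemma matrix_diff_ldistrib: "A ** (B - C) = A ** B - A ** C"
  for A :: "'a::ring_1^'n^'m"
  by (vector matrix_matrix_mult_def sum_subtractf[symmetric] right_diff_distrib)

lemma matrix_diff_rdistrib: "(A - B) ** C = A ** C - B ** C"
  for A B :: "'a::ring_1^'n^'m"
  by (vector matrix_matrix_mult_def sum_subtractf[symmetric] left_diff_distrib)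

lemma matrix_cancel:
  assumes "A ** B = mat 1"
  shows "A ** (B ** C) = C" "C ** A ** B = C"
  using assms by (simp_all add: matrix_mul_assoc) (simp flip: matrix_mul_assoc)

section \<open>Entrywise ring homomorphisms and derivations\<close>

definition unital_hom :: "('a::comm_ring_1 \<Rightarrow> 'b::comm_ring_1) \<Rightarrow> bool" where
  "unital_hom h \<longleftrightarrow> h 1 = 1 \<and> (\<forall>x y. h (x + y) = h x + h y) \<and> (\<forall>x y. h (x * y) = h x * h y)"

lemma unital_hom_0: "unital_hom h \<Longrightarrow> h 0 = 0"
  unfolding unital_hom_def by (metis add_cancel_right_left)

lemma unital_hom_sum: "unital_hom h \<Longrightarrow> h (sum f I) = (\<Sum>i\<in>I. h (f i))"
  by (induction I rule: infinite_finite_induct) (auto simp: unital_hom_0 unital_hom_def)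

lemma unital_hom_diff: "unital_hom h \<Longrightarrow> h (x - y) = h x - h y"
  unfolding unital_hom_def by (metis add_diff_cancel_right' diff_add_cancel)

lemma map_matrix_mult:
  "unital_hom h \<Longrightarrow> map_matrix h (A ** B) = map_matrix h A ** map_matrix h B"
  by (simp add: vec_eq_iff matrix_matrix_mult_def unital_hom_sum) (simp add: unital_hom_def)

lemma map_matrix_one: "unital_hom h \<Longrightarrow> map_matrix h (mat 1) = mat 1"
  by (simp add: vec_eq_iff mat_def unital_hom_0) (simp add: unital_hom_def)

lemma map_matrix_add: "unital_hom h \<Longrightarrow> map_matrix h (A + B) = map_matrix h A + map_matrix h B"
  by (simp add: vec_eq_iff) (simp add: unital_hom_def)

lemma map_matrix_diff: "unital_hom h \<Longrightarrow> map_matrix h (A - B) = map_matrix h A - map_matrix h B"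
  by (simp add: vec_eq_iff unital_hom_diff)

definition derivation :: "('a::comm_ring_1 \<Rightarrow> 'a) \<Rightarrow> bool" where
  "derivation D \<longleftrightarrow> (\<forall>x y. D (x + y) = D x + D y) \<and> (\<forall>x y. D (x * y) = x * D y + D x * y)"

lemma derivation_0: "derivation D \<Longrightarrow> D 0 = 0"
  unfolding derivation_def by (metis add_cancel_right_left)

lemma derivation_sum: "derivation D \<Longrightarrow> D (sum f I) = (\<Sum>i\<in>I. D (f i))"
  by (induction I rule: infinite_finite_induct) (auto simp: derivation_0 derivation_def)

lemma map_matrix_derivation_mult:
  "derivation D \<Longrightarrow> map_matrix D (A ** B) = A ** map_matrix D B + map_matrix D A ** B"
  by (simp add: vec_eq_iff matrix_matrix_mult_def derivation_sum)
    (simp add: derivation_def sum.distrib)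

lemma map_derivation_vec_mult:
  "derivation D \<Longrightarrow>
    (\<chi> i. D ((A *v v) $ i)) = A *v (\<chi> i. D (v $ i)) + map_matrix D A *v v"
  by (simp add: vec_eq_iff matrix_vector_mult_def derivation_sum)
    (simp add: derivation_def sum.distrib)

text \<open>
  The commutator of \<open>D + M\<close> with \<open>N\<close>, computed in the frame \<open>q\<close>.
\<close>

lemma gauge_transform:
  fixes q Q M N T :: "'a::comm_ring_1^'n^'n"
  assumes D: "derivation D" and q: "Q ** q = mat 1" "q ** Q = mat 1"
    and T: "T = Q ** N ** q" and M': "M' = Q ** (M ** q + map_matrix D q)"
  shows "Q ** (map_matrix D N + M ** N - N ** M) ** q = map_matrix D T + M' ** T - T ** M'"
proof -
  \<comment> \<open>Differentiating \<open>N ** q = q ** T\<close> avoids any derivative of the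
    inverse frame \<open>Q\<close>.\<close>
  have Nq: "N ** q = q ** T"
    unfolding T using q by (simp add: matrix_mul_assoc)
  have M'q: "q ** M' = M ** q + map_matrix D q"
    unfolding M' using q by (simp add: matrix_mul_assoc)
  have "N ** map_matrix D q + map_matrix D N ** q = q ** map_matrix D T + map_matrix D q ** T"
    using arg_cong[OF Nq, of "map_matrix D"] by (simp only: map_matrix_derivation_mult[OF D])
  then have DN: "map_matrix D N ** q = q ** map_matrix D T + map_matrix D q ** T - N ** map_matrix D q"
    by (simp add: algebra_simps)
  have MN: "M ** N ** q = M ** q ** T" by (simp add: Nq flip: matrix_mul_assoc)
  have NM: "N ** M ** q = q ** T ** M' - N ** map_matrix D q"
  proof -
    have "q ** T ** M' = N ** (q ** M')" by (simp add: Nq matrix_mul_assoc)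
    then show ?thesis unfolding M'q by (simp add: matrix_add_ldistrib matrix_mul_assoc)
  qed
  have "(map_matrix D N + M ** N - N ** M) ** q
      = q ** map_matrix D T + (M ** q + map_matrix D q) ** T - q ** T ** M'"
    by (simp add: matrix_add_rdistrib matrix_diff_rdistrib DN MN NM)
  also have "\<dots> = q ** (map_matrix D T + M' ** T - T ** M')"
    by (simp add: matrix_add_ldistrib matrix_diff_ldistrib matrix_mul_assoc M'q)
  finally have eq: "(map_matrix D N + M ** N - N ** M) ** q = q ** (map_matrix D T + M' ** T - T ** M')" .
  show ?thesis
    unfolding matrix_mul_assoc[symmetric, of Q] eq by (rule matrix_cancel(1)[OF q(1)])
qed

text \<open>Here \<open>E\<close> stands for the inverse of the change of basis \<open>B\<close>; as
  a separate argument it can be mapped entrywise into Laurent series along with \<open>B\<close>.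
  The condition is linear in \<open>X\<close>, which is what lets it pass from the torus to its Lie
  algebra and its Laurent series points.\<close>

definition diagonal_in ::
  "'a::comm_ring_1^'n^'n \<Rightarrow> 'a^'n^'n \<Rightarrow> 'a^'n^'n \<Rightarrow> bool" where
  "diagonal_in E B X \<longleftrightarrow> (\<forall>i j. i \<noteq> j \<longrightarrow> (E ** X ** B) $ i $ j = 0)"

lemma diagonal_in_commute:
  assumes E: "E ** B = mat 1" "B ** E = mat 1" and X: "diagonal_in E B X" and Y: "diagonal_in E B Y"
  shows "X ** Y = Y ** X"
proof -
  have diag: "(S ** T) $ i $ j = S $ i $ j * T $ i $ j"
    if "\<And>i j. i \<noteq> j \<Longrightarrow> S $ i $ j = 0" "\<And>i j. i \<noteq> j \<Longrightarrow> T $ i $ j = 0" for S T :: "'a^'n^'n" and i j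
  proof -
    have "(S ** T) $ i $ j = (\<Sum>k\<in>UNIV. if k = i then S $ i $ i * T $ i $ j else 0)"
      unfolding matrix_matrix_mult_def vec_lambda_beta using that by (intro sum.cong) auto
    then show ?thesis using that by (cases "i = j") auto
  qed
  have "(E ** X ** B) ** (E ** Y ** B) = (E ** Y ** B) ** (E ** X ** B)"
    using X Y unfolding diagonal_in_def by (simp add: vec_eq_iff diag mult.commute)
  moreover have "(E ** X ** B) ** (E ** Y ** B) = E ** (X ** Y) ** B" for X Y
    unfolding matrix_mul_assoc[symmetric] matrix_cancel(1)[OF E(2)] ..
  ultimately have "B ** (E ** (X ** Y) ** B) ** E = B ** (E ** (Y ** X) ** B) ** E" by simp
  then show ?thesis
    unfolding matrix_mul_assoc[symmetric] matrix_cancel(1)[OF E(2)] E(2) by simp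
qed

section \<open>Lie algebras of linear groups\<close>

text \<open>The ring is generic because the same equation is read over the constants, over Laurent
  series and over the polynomial ring in \<epsilon>.\<close>

definition linear_form :: "(('n \<times> 'n) \<Rightarrow> 'r) \<Rightarrow> 'r::comm_ring_1^'n^'n \<Rightarrow> 'r" where
  "linear_form l X = (\<Sum>ab\<in>UNIV. l ab * X $ fst ab $ snd ab)"

definition linear_poly :: "(('n::finite \<times> 'n) \<Rightarrow> complex) \<Rightarrow> 'n mat_poly" where
  "linear_poly l = (\<Sum>ab\<in>UNIV. Poly_Mapping.single (Poly_Mapping.single ab 1) (l ab))"

text \<open>Monomials with coefficient 0 are absent from \<open>keys\<close>; the assumption
  \<open>h 0 = 0\<close> allows the sum to be extended over all matrix positions.\<close>

lemma eval_linear_poly: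
  fixes l :: "('n::finite \<times> 'n) \<Rightarrow> complex" and x :: "'r::comm_ring_1^'n^'n"
  assumes "h 0 = 0"
  shows "eval_at h (linear_poly l) x = linear_form (\<lambda>ab. h (l ab)) x"
proof -
  let ?s = "\<lambda>ab :: 'n \<times> 'n. Poly_Mapping.single ab (1::nat)"
  have inj: "inj ?s" by (auto intro!: injI simp: poly_mapping_eq_iff fun_eq_iff Poly_Mapping.lookup_single when_def split: if_splits)
  have lookup: "Poly_Mapping.lookup (linear_poly l) (?s ab) = l ab" for ab
  proof -
    have "Poly_Mapping.lookup (linear_poly l) (?s ab) = (\<Sum>cd\<in>UNIV. l cd when ?s cd = ?s ab)"
      unfolding linear_poly_def by (simp add: lookup_sum Poly_Mapping.lookup_single)
    also have "\<dots> = (\<Sum>cd\<in>UNIV. if cd = ab then l cd else 0)"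
      by (simp add: when_def inj_eq[OF inj] del: One_nat_def)
    finally show ?thesis by simp
  qed
  have keys: "Poly_Mapping.keys (linear_poly l) \<subseteq> range ?s"
  proof
    fix m assume "m \<in> Poly_Mapping.keys (linear_poly l)"
    then have "(\<Sum>cd\<in>UNIV. l cd when ?s cd = m) \<noteq> 0"
      unfolding in_keys_iff linear_poly_def by (simp add: lookup_sum Poly_Mapping.lookup_single)
    then show "m \<in> range ?s" by (metis (mono_tags, lifting) rangeI sum.neutral when_simps(2))
  qed
  have "eval_at h (linear_poly l) x = (\<Sum>m\<in>range ?s. h (Poly_Mapping.lookup (linear_poly l) m) *
      (\<Prod>ij\<in>Poly_Mapping.keys m. (x $ fst ij $ snd ij) ^ Poly_Mapping.lookup m ij))"
    unfolding eval_at_def using keys assms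
    by (intro sum.mono_neutral_left) (auto simp: in_keys_iff)
  also have "\<dots> = (\<Sum>ab\<in>UNIV. h (l ab) * x $ fst ab $ snd ab)"
    by (subst sum.reindex[OF inj]) (simp add: lookup[simplified])
  finally show ?thesis by (simp add: linear_form_def)
qed

text \<open>Says that \<Phi>(X) is \<open>c\<close> plus \<epsilon> times a linear form in
  \<open>X\<close>, modulo the square of \<epsilon>. By the product rule this is stable under sums
  and products, hence it holds for every polynomial evaluated at 1 + \<epsilon> X.\<close>

definition first_order :: "(complex^'n^'n \<Rightarrow> complex poly) \<Rightarrow> complex \<Rightarrow> bool" where
  "first_order \<Phi> c \<longleftrightarrow> (\<forall>X. coeff (\<Phi> X) 0 = c) \<and> (\<exists>l. \<forall>X. coeff (\<Phi> X) 1 = linear_form l X)"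

lemma linear_form_add: "linear_form (\<lambda>ab. l ab + m ab) X = linear_form l X + linear_form m X"
  by (simp add: linear_form_def algebra_simps sum.distrib)

lemma linear_form_scale: "linear_form (\<lambda>ab. c * l ab) X = c * linear_form l X"
  by (simp add: linear_form_def sum_distrib_left mult_ac)

lemma linear_form_0: "linear_form (\<lambda>_. 0) X = 0"
  by (simp add: linear_form_def)

lemma first_order_const: "first_order (\<lambda>_. [:c:]) c"
  unfolding first_order_def using linear_form_0 by (auto intro!: exI[of _ "\<lambda>_. 0"])

lemma first_order_add:
  assumes "first_order \<Phi> c" "first_order \<Psi> e"
  shows "first_order (\<lambda>X. \<Phi> X + \<Psi> X) (c + e)"
proof -
  obtain l m where "\<forall>X. coeff (\<Phi> X) 1 = linear_form l X" "\<forall>X. coeff (\<Psi> X) 1 = linear_form m X"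
    using assms unfolding first_order_def by blast
  then show ?thesis
    using assms unfolding first_order_def
    by (auto simp: linear_form_add intro!: exI[of _ "\<lambda>ab. l ab + m ab"])
qed

lemma first_order_mult:
  assumes "first_order \<Phi> c" "first_order \<Psi> e"
  shows "first_order (\<lambda>X. \<Phi> X * \<Psi> X) (c * e)"
proof -
  obtain l m where "\<forall>X. coeff (\<Phi> X) 1 = linear_form l X" "\<forall>X. coeff (\<Psi> X) 1 = linear_form m X"
    using assms unfolding first_order_def by blast
  then show ?thesis
    using assms unfolding first_order_def
    by (auto simp: coeff_mult linear_form_add linear_form_scale intro!: exI[of _ "\<lambda>ab. c * m ab + e * l ab"])
qed

lemma first_order_sum:
  assumes "\<And>i. i \<in> I \<Longrightarrow> first_order (\<Phi> i) (c i)"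
  shows "first_order (\<lambda>X. \<Sum>i\<in>I. \<Phi> i X) (\<Sum>i\<in>I. c i)"
  using assms first_order_const[of 0]
  by (induction I rule: infinite_finite_induct) (auto intro!: first_order_add)

lemma first_order_prod:
  assumes "\<And>i. i \<in> I \<Longrightarrow> first_order (\<Phi> i) (c i)"
  shows "first_order (\<lambda>X. \<Prod>i\<in>I. \<Phi> i X) (\<Prod>i\<in>I. c i)"
  using assms first_order_const[of 1]
  by (induction I rule: infinite_finite_induct) (auto intro!: first_order_mult simp: one_pCons)

lemma first_order_power: "first_order \<Phi> c \<Longrightarrow> first_order (\<lambda>X. \<Phi> X ^ k) (c ^ k)"
  using first_order_const[of 1]
  by (induction k) (auto intro!: first_order_mult simp: one_pCons)

lemma first_order_entry:
  "first_order (\<lambda>X. (mat 1 + map_matrix (\<lambda>c. [:0, c:]) X) $ a $ b) ((mat 1 :: complex^'n^'n) $ a $ b)"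
proof -
  have "linear_form (\<lambda>cd. if cd = (a, b) then 1 else 0) X = X $ a $ b" for X :: "complex^'n^'n"
    unfolding linear_form_def by (simp add: if_distrib[of "\<lambda>y. y * _"] cong: if_cong)
  then show ?thesis
    unfolding first_order_def
    by (auto simp: mat_def intro!: exI[of _ "\<lambda>cd. if cd = (a, b) then 1 else 0"])
qed

lemma first_order_eval:
  "first_order (\<lambda>X :: complex^'n^'n. eval_at (\<lambda>c. [:c:]) p (mat 1 + map_matrix (\<lambda>c. [:0, c:]) X))
     (eval_at id p (mat 1))"
  unfolding eval_at_def id_def
  by (intro first_order_sum first_order_mult first_order_prod first_order_power first_order_const
      first_order_entry)

lemma dual_number_dvd_iff: "[:0, 1:]\<^sup>2 dvd p \<longleftrightarrow> coeff p 0 = 0 \<and> coeff p 1 = 0" for p :: "complex poly"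
proof -
  have "[:0, 1:]\<^sup>2 = monom (1::complex) 2" by (simp add: monom_altdef)
  then show ?thesis by (auto simp: monom_1_dvd_iff' numeral_2_eq_2 less_Suc_eq)
qed

text \<open>An equation of \<open>H\<close> holds at the identity, so its constant term in
  \<epsilon> vanishes and the divisibility reduces to the vanishing of its differential
  there.\<close>

lemma lie_algebra_linear:
  fixes H :: "(complex^'n^'n) set"
  assumes "mat 1 \<in> H"
  obtains L where "lie_algebra H = {X. \<forall>l\<in>L. linear_form l X = 0}"
proof -
  have "\<exists>l. \<forall>X :: complex^'n^'n. [:0, 1:]\<^sup>2 dvd eval_at (\<lambda>c. [:c:]) p (mat 1 + map_matrix (\<lambda>c. [:0, c:]) X)
      \<longleftrightarrow> linear_form l X = 0" if "p \<in> vanishing_ideal H" for p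
  proof -
    have "eval_at id p (mat 1) = 0" using that assms by (auto simp: vanishing_ideal_def)
    then show ?thesis
      using first_order_eval[of p] unfolding first_order_def dual_number_dvd_iff by force
  qed
  then obtain l where l: "\<And>p X. p \<in> vanishing_ideal H \<Longrightarrow>
      [:0, 1:]\<^sup>2 dvd eval_at (\<lambda>c. [:c:]) p (mat 1 + map_matrix (\<lambda>c. [:0, c:]) X) \<longleftrightarrow> linear_form (l p) X = 0"
    by metis
  have "lie_algebra H = {X. \<forall>l\<in>l ` vanishing_ideal H. linear_form l X = 0}"
    unfolding lie_algebra_def using l by auto
  then show ?thesis using that by blast
qed

text \<open>A linear form is its own differential.\<close>

lemma lie_algebra_linear_form:
  assumes "\<And>x. x \<in> H \<Longrightarrow> linear_form l x = 0" "X \<in> lie_algebra H"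
  shows "linear_form l X = 0"
proof -
  have "linear_poly l \<in> vanishing_ideal H"
    using assms by (auto simp: vanishing_ideal_def eval_linear_poly)
  then have "[:0, 1:]\<^sup>2 dvd linear_form (\<lambda>ab. [:l ab:]) (mat 1 + map_matrix (\<lambda>c. [:0, c:]) X)"
    using assms(2) by (auto simp: lie_algebra_def eval_linear_poly)
  then have "coeff (linear_form (\<lambda>ab. [:l ab:]) (mat 1 + map_matrix (\<lambda>c. [:0, c:]) X)) 1 = 0"
    by (simp only: dual_number_dvd_iff)
  moreover have "coeff ((mat 1 + map_matrix (\<lambda>c. [:0, c:]) X) $ a $ b) 1 = X $ a $ b" for a b
    by (simp add: mat_def)
  ultimately show ?thesis by (simp add: linear_form_def coeff_sum)
qed

lemma loop_pts_linear_form: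
  assumes "\<And>x. x \<in> Z \<Longrightarrow> linear_form l x = 0" "x \<in> loop_pts Z"
  shows "linear_form (\<lambda>ab. fls_const (l ab)) x = 0"
proof -
  have "linear_poly l \<in> vanishing_ideal Z"
    using assms by (auto simp: vanishing_ideal_def eval_linear_poly)
  then show ?thesis using assms(2) by (auto simp: pts_def eval_linear_poly)
qed

lemma triple_product_linear_form:
  fixes A X B :: "'a::comm_ring_1^'n^'n"
  shows "(A ** X ** B) $ i $ j = linear_form (\<lambda>ab. A $ i $ fst ab * B $ snd ab $ j) X"
proof -
  have "(A ** X ** B) $ i $ j = (\<Sum>b\<in>UNIV. \<Sum>a\<in>UNIV. A $ i $ a * B $ b $ j * X $ a $ b)"
    by (simp add: matrix_matrix_mult_def sum_distrib_left sum_distrib_right mult_ac)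
  also have "\<dots> = linear_form (\<lambda>ab. A $ i $ fst ab * B $ snd ab $ j) X"
    unfolding linear_form_def
    by (subst sum.swap) (simp add: sum.cartesian_product case_prod_unfold flip: UNIV_Times_UNIV)
  finally show ?thesis .
qed

lemma lie_algebra_diagonal:
  assumes "\<And>x. x \<in> H \<Longrightarrow> diagonal_in E B x" "X \<in> lie_algebra H"
  shows "diagonal_in E B X"
  using assms lie_algebra_linear_form[of H _ X]
  unfolding diagonal_in_def triple_product_linear_form by blast

section \<open>Linear equations over Laurent series\<close>

lemma unital_hom_const: "unital_hom (fls_const :: complex \<Rightarrow> complex fls)"
  by (auto simp: unital_hom_def fls_plus_const)

text \<open>The factor \<open>C\<close> is there for cosets of the torus: if \<open>C\<close> is the
  inverse of a representative, right multiplication by it brings the coset back into the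
  torus.\<close>

lemma loop_pts_diagonal:
  fixes C :: "complex^'n^'n"
  assumes "\<And>x. x \<in> Z \<Longrightarrow> diagonal_in E B (x ** C)" "x \<in> loop_pts Z"
  shows "diagonal_in (map_matrix fls_const E) (map_matrix fls_const B) (x ** map_matrix fls_const C)"
proof -
  have eq: "E ** (x ** C) ** B = E ** x ** (C ** B)" for E x C B :: "'r::comm_ring_1^'n^'n"
    by (simp add: matrix_mul_assoc)
  have "linear_form (\<lambda>ab. fls_const (E $ i $ fst ab * (C ** B) $ snd ab $ j)) x = 0" if "i \<noteq> j" for i j
    using assms that
    by (intro loop_pts_linear_form[OF _ assms(2)])
      (auto simp: diagonal_in_def eq triple_product_linear_form)
  then show ?thesis
    unfolding diagonal_in_def eq triple_product_linear_form
    by (simp add: map_matrix_mult[OF unital_hom_const, symmetric])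
qed

text \<open>The linear equations of the Lie algebra, imposed on each coefficient, amount to the same
  equations on the series. Since their coefficients are constants, derivations that kill constants
  preserve the solutions.\<close>

lemma loop_lie_linear:
  fixes H :: "(complex^'n^'n) set"
  assumes "mat 1 \<in> H"
  obtains L where "loop_lie H = {M. \<forall>l\<in>L. linear_form (\<lambda>ab. fls_const (l ab)) M = 0}"
proof -
  obtain L where L: "lie_algebra H = {X. \<forall>l\<in>L. linear_form l X = 0}"
    using lie_algebra_linear[OF assms] by blast
  have nth: "fls_nth (linear_form (\<lambda>ab. fls_const (l ab)) M) k = linear_form l (mat_coeff M k)"
    for l and M :: "complex fls^'n^'n" and k
  proof -
    have "fls_nth (sum f I) k = (\<Sum>i\<in>I. fls_nth (f i) k)" for f :: "'n \<times> 'n \<Rightarrow> complex fls" and I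
      by (induction I rule: infinite_finite_induct) auto
    then show ?thesis by (simp add: linear_form_def mat_coeff_def)
  qed
  have "loop_lie H = {M. \<forall>l\<in>L. linear_form (\<lambda>ab. fls_const (l ab)) M = 0}"
    unfolding loop_lie_def L by (auto simp: fls_eq_iff nth)
  then show ?thesis using that by blast
qed

lemma loop_lie_derivation:
  assumes "mat 1 \<in> H" "derivation D" "\<And>c. D (fls_const c) = 0" "M \<in> loop_lie H"
  shows "map_matrix D M \<in> loop_lie H"
proof -
  obtain L where L: "loop_lie H = {M. \<forall>l\<in>L. linear_form (\<lambda>ab. fls_const (l ab)) M = 0}"
    using loop_lie_linear[OF assms(1)] by blast
  have "linear_form (\<lambda>ab. fls_const (l ab)) (map_matrix D M)
      = D (linear_form (\<lambda>ab. fls_const (l ab)) M)" for l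
    using assms(2,3) by (simp add: linear_form_def derivation_sum) (simp add: derivation_def)
  then show ?thesis using assms(4) derivation_0[OF assms(2)] unfolding L by auto
qed

lemma loop_lie_0: "mat 1 \<in> H \<Longrightarrow> 0 \<in> loop_lie H"
  by (erule loop_lie_linear) (simp add: linear_form_def)

lemma loop_lie_diagonal:
  assumes H: "mat 1 \<in> H" "\<And>x. x \<in> H \<Longrightarrow> diagonal_in E B x" and M: "M \<in> loop_lie H"
  shows "diagonal_in (map_matrix fls_const E) (map_matrix fls_const B) M"
proof -
  have nth: "fls_nth (sum f I) k = (\<Sum>i\<in>I. fls_nth (f i) k)" for f :: "'n \<times> 'n \<Rightarrow> complex fls" and I k
    by (induction I rule: infinite_finite_induct) auto
  have "fls_nth ((map_matrix fls_const E ** M ** map_matrix fls_const B) $ i $ j) k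
      = (E ** mat_coeff M k ** B) $ i $ j" for i j k
    unfolding triple_product_linear_form
    by (simp add: linear_form_def nth mat_coeff_def mult.assoc)
  moreover have "diagonal_in E B (mat_coeff M k)" for k
    using lie_algebra_diagonal[OF H(2)] M by (auto simp: loop_lie_def)
  ultimately show ?thesis by (auto simp: diagonal_in_def fls_eq_iff)
qed

section \<open>Ramified covers of the punctured disc\<close>

lemma unital_hom_pull: "d > 0 \<Longrightarrow> unital_hom (pull d)"
  by (auto simp: unital_hom_def pull_def)

lemma pull_eq_0_iff:
  assumes "d > 0"
  shows "pull d x = 0 \<longleftrightarrow> x = 0"
proof
  assume "pull d x = 0"
  then have "fls_nth (pull d x) (int d * k) = 0" for k by simp
  then show "x = 0" using assms by (simp add: pull_def fls_nth_compose_power fls_eq_iff)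
qed (simp add: pull_def)

lemma unital_hom_deck: "unital_hom (deck d)"
proof -
  have "cis (2 * pi / real d) \<noteq> 0" by simp
  then have "fps_const (cis (2 * pi / real d)) * fps_X \<noteq> 0" by (simp del: cis_neq_zero)
  then show ?thesis
    by (auto simp: unital_hom_def deck_def fls_compose_fps_mult fls_compose_fps_add)
qed

lemma deck_const: "deck d (fls_const c) = fls_const c"
  by (simp add: deck_def)

text \<open>Only exponents divisible by \<open>d\<close> occur, and the \<open>d\<close>-th power of
  the root of unity is 1.\<close>

lemma deck_pull:
  assumes "d > 0"
  shows "deck d (pull d x) = pull d x"
proof (rule fls_eqI)
  fix n
  have "cis (2 * pi / real d) powi (int d * k) = 1" for k
  proof -
    have "cis (2 * pi / real d) ^ d = cis (real d * (2 * pi / real d))"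
      by (rule Complex.DeMoivre)
    also have "\<dots> = 1" using assms by simp
    finally have "cis (2 * pi / real d) ^ d = 1" .
    then show ?thesis by (simp add: power_int_mult)
  qed
  then show "fls_nth (deck d (pull d x)) n = fls_nth (pull d x) n"
    using assms
    by (auto simp: deck_def fls_nth_fls_compose_fps_linear pull_def fls_nth_compose_power elim!: dvdE)
qed

lemma dz_nth: "fls_nth (dz d x) n = of_int (n + int d) / of_nat d * fls_nth x (n + int d)"
proof -
  have "dz d x = fls_const (1 / of_nat d) * fls_shift (int d - 1) (fls_deriv x)"
    unfolding dz_def mult.assoc fls_X_intpow_times_conv_shift(1) by simp
  then show ?thesis by (simp add: field_simps)
qed

lemma dz_pull:
  assumes "d > 0"
  shows "dz d (pull d x) = pull d (fls_deriv x)"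
proof (rule fls_eqI)
  fix n
  show "fls_nth (dz d (pull d x)) n = fls_nth (pull d (fls_deriv x)) n"
  proof (cases "int d dvd n")
    case True
    then obtain k where "n = int d * k" by (elim dvdE)
    moreover have "int d * k + int d = int d * (k + 1)" by (simp add: algebra_simps)
    ultimately show ?thesis
      using assms by (simp add: dz_nth pull_def fls_nth_compose_power field_simps)
  qed (use assms in \<open>simp add: dz_nth pull_def fls_nth_compose_power\<close>)
qed

lemma derivation_scaled_deriv: "derivation (\<lambda>x :: complex fls. f * fls_deriv x)"
  by (auto simp: derivation_def algebra_simps)

lemma derivation_scaled_dz: "derivation (\<lambda>x. f * dz d x)"
  by (auto simp: derivation_def dz_def algebra_simps)

lemma dz_const: "dz d (fls_const c) = 0"
  by (simp add: dz_def)

lemma dz_eq_0_imp_const: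
  assumes "d > 0" "dz d x = 0"
  shows "x = fls_const (fls_nth x 0)"
proof -
  have "fls_X_intpow (1 - int d) \<noteq> (0 :: complex fls)"
    by (metis fls_X_intpow_nonzero)
  then have "fls_deriv x = 0" using assms by (simp add: dz_def)
  then show ?thesis by (simp add: fls_deriv_eq_0_iff)
qed

text \<open>A bound on the order that also holds for the zero series, whose
  \<open>fls_subdegree\<close> is 0 by convention; sums and products then need no case
  distinction.\<close>

definition vanishes_below :: "int \<Rightarrow> complex fls \<Rightarrow> bool" where
  "vanishes_below k x \<longleftrightarrow> (\<forall>i<k. fls_nth x i = 0)"

lemma vanishes_below_0: "vanishes_below k 0"
  by (simp add: vanishes_below_def)

lemma vanishes_below_mono: "vanishes_below k x \<Longrightarrow> l \<le> k \<Longrightarrow> vanishes_below l x"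
  by (auto simp: vanishes_below_def)

lemma vanishes_below_subdegree: "vanishes_below (fls_subdegree x) x"
  by (simp add: vanishes_below_def)

lemma vanishes_below_iff: "x \<noteq> 0 \<Longrightarrow> vanishes_below k x \<longleftrightarrow> k \<le> fls_subdegree x"
  unfolding vanishes_below_def
  by (metis fls_subdegree_geI fls_eq0_below_subdegree order_less_le_trans)

lemma vanishes_below_mult:
  assumes "vanishes_below k x" "vanishes_below l y"
  shows "vanishes_below (k + l) (x * y)"
proof (cases "x = 0 \<or> y = 0")
  case False
  then show ?thesis using assms by (simp add: vanishes_below_iff)
qed (auto simp: vanishes_below_0)

lemma vanishes_below_sum:
  "(\<And>i. i \<in> I \<Longrightarrow> vanishes_below k (f i)) \<Longrightarrow> vanishes_below k (sum f I)"
  by (induction I rule: infinite_finite_induct) (auto simp: vanishes_below_def)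

lemma vanishes_below_dz: "vanishes_below k x \<Longrightarrow> vanishes_below (k - int d) (dz d x)"
  by (auto simp: vanishes_below_def dz_nth)

lemma vanishes_below_pull:
  assumes "d > 0"
  shows "vanishes_below (int d * k) (pull d x) \<longleftrightarrow> vanishes_below k x"
proof
  assume "vanishes_below (int d * k) (pull d x)"
  then have "fls_nth (pull d x) (int d * i) = 0" if "i < k" for i
    using that assms by (simp add: vanishes_below_def)
  then show "vanishes_below k x"
    using assms by (simp add: vanishes_below_def pull_def fls_nth_compose_power)
next
  assume "vanishes_below k x"
  then show "vanishes_below (int d * k) (pull d x)"
    using assms by (auto simp: vanishes_below_def pull_def fls_nth_compose_power elim!: dvdE)
qed

lemma finite_vanishes_below:
  assumes "finite S"
  obtains k where "\<And>x. x \<in> S \<Longrightarrow> vanishes_below k x"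
proof -
  have "\<exists>k. \<forall>x\<in>S. vanishes_below k x"
    using assms
  proof (induction S rule: finite_induct)
    case (insert x S)
    then obtain k where "\<forall>x\<in>S. vanishes_below k x" by auto
    then show ?case using vanishes_below_subdegree[of x] vanishes_below_mono
      by (intro exI[of _ "min k (fls_subdegree x)"]) (metis insertE min.cobounded1 min.cobounded2)
  qed auto
  then show ?thesis using that by blast
qed

lemma matrix_vanishes_below:
  fixes M :: "complex fls^'n^'m"
  obtains k where "\<And>i j. vanishes_below k (M $ i $ j)"
proof -
  have "finite (range (\<lambda>ij. M $ fst ij $ snd ij))" by simp
  then obtain k where "\<And>x. x \<in> range (\<lambda>ij. M $ fst ij $ snd ij) \<Longrightarrow> vanishes_below k x"
    using finite_vanishes_below by blast
  then have "vanishes_below k (M $ i $ j)" for i j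
    by (metis fst_conv snd_conv rangeI)
  then show ?thesis using that by blast
qed

lemma matrix_vec_vanishes_below:
  assumes "\<And>i j. vanishes_below k (M $ i $ j)" "\<And>i. vanishes_below l (v $ i)"
  shows "vanishes_below (k + l) ((M *v v) $ i)"
  unfolding matrix_vector_mult_def using assms
  by (auto intro!: vanishes_below_sum vanishes_below_mult)

lemma matrix_mult_vanishes_below:
  assumes "\<And>i j. vanishes_below k (M $ i $ j)" "\<And>i j. vanishes_below l (N $ i $ j)"
  shows "vanishes_below (k + l) ((M ** N) $ i $ j)"
  unfolding matrix_matrix_mult_def using assms
  by (auto intro!: vanishes_below_sum vanishes_below_mult)

section \<open>Discreteness of the sections over the affine part\<close>

lemma matrix_vec_combination:
  fixes N :: "'a::comm_ring_1^'n^'m"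
  shows "N *v (\<Sum>s\<in>T. a s *s s) = (\<Sum>s\<in>T. a s *s (N *v s))"
proof -
  have "N *v (c *s v) = c *s (N *v v)" for c v
    by (simp add: vec_eq_iff matrix_vector_mult_def sum_distrib_left mult_ac)
  then show ?thesis
    by (induction T rule: infinite_finite_induct) (auto simp: matrix_vector_right_distrib)
qed

lemma common_denominator:
  assumes C: "pointed_curve F" and t: "t \<in> regular_functions F (affine_part F)" "fls_subdegree t = -1"
    and S: "finite S" "S \<subseteq> F"
  obtains g where "g \<noteq> 0" "\<And>y. y \<in> S \<Longrightarrow> evl t g * y \<in> range (evl t)"
proof -
  have "\<exists>g. g \<noteq> 0 \<and> (\<forall>y\<in>S. evl t g * y \<in> range (evl t))"
    using S
  proof (induction S rule: finite_induct)
    case empty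
    then show ?case by (intro exI[of _ 1]) auto
  next
    case (insert x S)
    then obtain g where g: "g \<noteq> 0" "\<forall>y\<in>S. evl t g * y \<in> range (evl t)" by auto
    obtain h p where h: "h \<noteq> 0" "evl t h * x = evl t p"
      using function_field_fraction[OF C t] insert.prems by (metis insert_subset)
    have "evl t (g * h) * y \<in> range (evl t)" if "y \<in> insert x S" for y
    proof (cases "y = x")
      case True
      then have "evl t (g * h) * y = evl t (g * p)" using h by (simp add: evl_mult mult.assoc)
      then show ?thesis by blast
    next
      case False
      then have "evl t g * y \<in> range (evl t)" using g(2) that by auto
      then obtain r where "evl t g * y = evl t r" by blast
      then have "evl t (g * h) * y = evl t (h * r)" by (simp add: evl_mult mult_ac)
      then show ?thesis by blast
    qed
    then show ?case using g h by (intro exI[of _ "g * h"]) auto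
  qed
  then show ?thesis using that by blast
qed

text \<open>Any point at which \<open>t\<close> is regular will do, since \<open>t\<close> has a
  pole at infinity.\<close>

lemma affine_point_exists:
  assumes C: "pointed_curve F" and t: "t \<in> regular_functions F (affine_part F)" "fls_subdegree t = -1"
  obtains R where "R \<in> affine_part F"
proof -
  have "t \<in> F" using t by (auto simp: regular_functions_def)
  then obtain R where R: "R \<in> points F" "t \<in> R"
    using valuation_ring_exists[OF pointed_curveD[OF C], of t] t by auto
  moreover have "t \<notin> infinity_pt F" using t by (auto simp: infinity_pt_def)
  ultimately show ?thesis using that by (auto simp: affine_part_def)
qed

text \<open>In a local frame at a single affine point the generators of \<open>V\<close> have
  coordinates in \<open>F\<close>. A common denominator \<open>g\<close> turns all coordinates of
  elements of \<open>V\<close> into polynomials in \<open>t\<close>, and such a polynomial is zero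
  once it vanishes at infinity. That the frame lies in the Laurent series span of \<open>V\<close>
  will show that a matrix killing \<open>V\<close> is zero.\<close>

lemma torsor_module_discrete:
  fixes V :: "(complex fls^'n) set"
  assumes C: "pointed_curve F" and t: "t \<in> regular_functions F (affine_part F)" "fls_subdegree t = -1"
    and V: "torsor_module F G V"
  obtains B and \<delta> :: "complex fls^'n^'n" and k where
    "finite B" "V = span_over (*s) (range (evl t)) B" "invertible \<delta>"
    "\<forall>j. \<delta> *v axis j 1 \<in> span_over (*s) UNIV V"
    "\<forall>v\<in>V. (\<forall>i. vanishes_below k (v $ i)) \<longrightarrow> v = 0"
proof -
  have neg: "fls_subdegree t < 0" using t by simp
  obtain B where B: "finite B" "V = span_over (*s) (range (evl t)) B"
    using V regular_functions_affine_part[OF C t] by (auto simp: torsor_module_def)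
  have A: "subalg (range (evl t))" by (rule subalg_range_evl)
  have V_eq: "V = {\<Sum>s\<in>B. a s *s s | a. a ` B \<subseteq> range (evl t)}"
    unfolding B(2) by (rule span_over_finite) (use B A in \<open>auto intro: subalg_0\<close>)
  obtain R where R: "R \<in> affine_part F" using affine_point_exists[OF C t] .
  then have R': "subalg R" "R \<subseteq> F" by (auto simp: affine_part_def points_def)
  from V R obtain \<delta> :: "complex fls^'n^'n" where \<delta>: "invertible \<delta>"
      "span_over (*s) R V = {\<delta> *v c | c. \<forall>i. c $ i \<in> R}"
    unfolding torsor_module_def by blast
  define E where "E = matrix_inv \<delta>"
  have E: "\<delta> ** E = mat 1" "E ** \<delta> = mat 1"
    unfolding E_def using matrix_inv_mult[OF \<delta>(1)] by auto
  have mem: "(E *v b) $ i \<in> F" if "b \<in> B" for b i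
  proof -
    have "b = (\<Sum>s\<in>{b}. (\<lambda>_. 1) s *s s)" by simp
    then have "b \<in> V" unfolding B(2) span_over_def using that subalg_1[OF A]
      by (intro CollectI exI[of _ "{b}"] exI[of _ "\<lambda>_. 1"]) auto
    then have "b \<in> span_over (*s) R V" unfolding span_over_def using subalg_1[OF R'(1)]
      by (intro CollectI exI[of _ "{b}"] exI[of _ "\<lambda>_. 1"]) auto
    then obtain c where c: "b = \<delta> *v c" "\<forall>i. c $ i \<in> R" unfolding \<delta>(2) by blast
    then have "E *v b = c" using E by (simp add: matrix_vector_mul_assoc)
    then show ?thesis using c R' by auto
  qed
  define S where "S = (\<lambda>(b, i). (E *v b) $ i) ` (B \<times> UNIV)"
  have "finite S" "S \<subseteq> F" unfolding S_def using B mem by auto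
  then obtain g where g: "g \<noteq> 0" "\<And>y. y \<in> S \<Longrightarrow> evl t g * y \<in> range (evl t)"
    using common_denominator[OF C t] by blast
  obtain kE where kE: "\<And>i j. vanishes_below kE (E $ i $ j)" using matrix_vanishes_below[of E] by blast
  define kg where "kg = fls_subdegree (evl t g)"
  have kg: "vanishes_below kg (evl t g)" unfolding kg_def by (rule vanishes_below_subdegree)
  \<comment> \<open>The bound makes \<open>evl t g * (E *v v) $ i\<close> vanish to order at least
    1: \<open>kE\<close> is lost to \<open>E\<close> and \<open>kg\<close> to the denominator. A
    nonzero polynomial in \<open>t\<close> has order at most 0.\<close>
  have zero: "v = 0" if v: "v \<in> V" "\<And>i. vanishes_below (1 - kg - kE) (v $ i)" for v
  proof -
    obtain a where a: "v = (\<Sum>s\<in>B. a s *s s)" "a ` B \<subseteq> range (evl t)" using v(1) V_eq by auto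
    have "(E *v v) $ i = 0" for i
    proof -
      have "evl t g * (E *v v) $ i = (\<Sum>s\<in>B. a s * (evl t g * (E *v s) $ i))"
        unfolding a(1) matrix_vec_combination by (simp add: sum_distrib_left mult_ac)
      also have "\<dots> \<in> range (evl t)"
      proof (rule subalg_sum[OF A])
        fix s assume "s \<in> B"
        then have "a s \<in> range (evl t)" "(E *v s) $ i \<in> S" using a(2) by (auto simp: S_def)
        then show "a s * (evl t g * (E *v s) $ i) \<in> range (evl t)"
          by (intro subalg_mult[OF A _ g(2)])
      qed
      finally obtain p where p: "evl t g * (E *v v) $ i = evl t p" by auto
      have "vanishes_below (kg + (kE + (1 - kg - kE))) (evl t g * (E *v v) $ i)"
        by (intro vanishes_below_mult kg matrix_vec_vanishes_below kE v)
      then have one: "vanishes_below 1 (evl t p)" unfolding p by simp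
      have "p = 0"
      proof (rule ccontr)
        assume "p \<noteq> 0"
        with evl_subdegree[OF neg this] one t(2) show False by (simp add: vanishes_below_iff)
      qed
      then show ?thesis using p g(1) evl_eq_0_iff[OF neg, of g] by simp
    qed
    then have "E *v v = 0" by (simp add: vec_eq_iff)
    then have "\<delta> *v (E *v v) = 0" by simp
    then show ?thesis using E by (simp add: matrix_vector_mul_assoc)
  qed
  have frame: "\<delta> *v axis j 1 \<in> span_over (*s) UNIV V" for j
  proof -
    have "\<delta> *v axis j 1 \<in> span_over (*s) R V"
      unfolding \<delta>(2) using subalg_0[OF R'(1)] subalg_1[OF R'(1)] by (auto simp: axis_def)
    then show ?thesis unfolding span_over_def by blast
  qed
  show ?thesis by (rule that[OF B \<delta>(1)]) (use frame zero in auto)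
qed

lemma span_over_diff:
  assumes "subalg A" "finite B" "u \<in> span_over (*s) A B" "v \<in> span_over (*s) A B"
  shows "u - v \<in> span_over (*s) A B"
proof -
  have eq: "span_over (*s) A B = {\<Sum>s\<in>B. a s *s s | a. a ` B \<subseteq> A}"
    by (rule span_over_finite) (use assms in \<open>auto intro: subalg_0\<close>)
  obtain a b where "u = (\<Sum>s\<in>B. a s *s s)" "a ` B \<subseteq> A" "v = (\<Sum>s\<in>B. b s *s s)" "b ` B \<subseteq> A"
    using assms(3,4) unfolding eq by blast
  moreover from this have "u - v = (\<Sum>s\<in>B. (a s - b s) *s s)"
    by (simp add: sum_subtractf vector_sub_rdistrib)
  ultimately show ?thesis
    unfolding eq using assms(1)
    by (intro CollectI exI[of _ "\<lambda>s. a s - b s"]) (auto intro: subalg_diff)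
qed

lemma zero_in_span_over: "0 \<in> span_over sc A B"
  unfolding span_over_def by (intro CollectI exI[of _ "{}"]) auto

lemma deriv_evl: "fls_deriv (evl t p) = evl t (pderiv p) * fls_deriv t"
  by (induction p) (auto simp: pderiv_pCons evl_add algebra_simps)

text \<open>With \<open>f = inverse (fls_deriv t)\<close>, the field \<open>f d/dz\<close> is
  \<open>d/dt\<close>. The derivative of a simple pole has a double pole, so \<open>f\<close> has a
  double zero at infinity.\<close>

lemma coordinate_vector_field:
  assumes C: "pointed_curve F" and t: "t \<in> regular_functions F (affine_part F)" "fls_subdegree t = -1"
  shows "inverse (fls_deriv t) \<in> vector_fields F" "vanishes_below 2 (inverse (fls_deriv t))"
    "inverse (fls_deriv t) \<noteq> 0"
proof -
  have sd: "fls_subdegree (fls_deriv t) = -2" using t by (simp add: fls_subdegree_deriv)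
  then have nz: "fls_deriv t \<noteq> 0" by auto
  then show "inverse (fls_deriv t) \<noteq> 0" by simp
  with sd show "vanishes_below 2 (inverse (fls_deriv t))"
    by (simp add: vanishes_below_iff fls_inverse_subdegree)
  show "inverse (fls_deriv t) \<in> vector_fields F"
    unfolding vector_fields_def regular_functions_affine_part[OF C t]
  proof (intro CollectI ballI)
    fix x assume "x \<in> range (evl t)"
    then obtain p where "x = evl t p" by blast
    then have "inverse (fls_deriv t) * fls_deriv x = evl t (pderiv p)"
      using nz by (simp add: deriv_evl)
    then show "inverse (fls_deriv t) * fls_deriv x \<in> range (evl t)" by simp
  qed
qed

section \<open>Horizontal sections\<close>

lemma weyl_group_coset:
  assumes "w \<in> carrier (weyl_group G H)"
  obtains n0 where "n0 \<in> norm_group G H" "w = (\<lambda>h. h ** n0) ` H"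
proof -
  let ?N = "mat_group (norm_group G H)"
  have "w \<in> (\<Union>n\<in>carrier ?N. {H #>\<^bsub>?N\<^esub> n})"
    using assms by (simp add: weyl_group_def FactGroup_def RCOSETS_def)
  then obtain n0 where n0: "n0 \<in> carrier ?N" "w = H #>\<^bsub>?N\<^esub> n0" by blast
  have "w = (\<Union>h\<in>H. {h ** n0})"
    unfolding n0(2) r_coset_def by (simp add: mat_group_def)
  then have "w = (\<lambda>h. h ** n0) ` H" by blast
  then show ?thesis using that n0(1) by (simp add: mat_group_def)
qed

lemma algebraic_group_mem:
  assumes "algebraic_group G"
  shows "mat 1 \<in> G" "x \<in> G \<Longrightarrow> invertible x"
proof -
  interpret subgroup G "mat_group {x. invertible x}"
    using assms by (simp add: algebraic_group_def)
  show "mat 1 \<in> G" using one_closed by (simp add: mat_group_def)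
  show "x \<in> G \<Longrightarrow> invertible x" using subset by (auto simp: mat_group_def)
qed

lemma map_matrix_const_mat_coeff:
  "(\<And>i j. M $ i $ j = fls_const (fls_nth (M $ i $ j) 0)) \<Longrightarrow> M = map_matrix fls_const (mat_coeff M 0)"
  by (simp add: vec_eq_iff mat_coeff_def)

lemma map_matrix_const_inj:
  assumes "map_matrix fls_const X = map_matrix fls_const Y"
  shows "X = Y"
proof -
  have "fls_nth (map_matrix fls_const X $ i $ j) 0 = fls_nth (map_matrix fls_const Y $ i $ j) 0" for i j
    unfolding assms ..
  then show ?thesis by (simp add: vec_eq_iff)
qed

text \<open>A pulled-back matrix is invariant under the deck transformation, and so is a constant
  one; comparing the two through \<open>q\<close> makes \<open>X\<close> commute with the monodromy.
  Since \<open>X\<close> also commutes with \<open>H\<close>, the whole coset \<open>w\<close> fixes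
  it, and ellipticity applies.\<close>

theorem elliptic_no_constant_sections:
  fixes G H w :: "(complex^'n^'n) set" and q N :: "complex fls^'n^'n"
  assumes G: "algebraic_group G" and H: "cartan_subgroup H G" and d: "d > 0"
    and q: "invertible q" and w: "has_monodromy G H d q w" "elliptic H w"
    and T: "matrix_inv q ** map_matrix (pull d) N ** q = map_matrix fls_const X"
      "X \<in> lie_algebra H"
  shows "N = 0"
proof -
  define Q where "Q = matrix_inv q"
  have Q: "Q ** q = mat 1" "q ** Q = mat 1" unfolding Q_def using matrix_inv_mult[OF q] by auto
  define T where "T = map_matrix fls_const X"
  have torus: "torus H" and HG: "H \<subseteq> G" using H unfolding cartan_subgroup_def by blast+
  from torus obtain B :: "complex^'n^'n" where B: "invertible B"
      "\<forall>t\<in>H. \<forall>i j. i \<noteq> j \<longrightarrow> (matrix_inv B ** t ** B) $ i $ j = 0"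
    unfolding torus_def by (elim conjE exE)
  define E where "E = matrix_inv B"
  have E: "E ** B = mat 1" "B ** E = mat 1" unfolding E_def using matrix_inv_mult[OF B(1)] by auto
  have Hdiag: "diagonal_in E B x" if "x \<in> H" for x
    unfolding diagonal_in_def E_def using bspec[OF B(2) that] .
  note hom = unital_hom_const
  define E' B' where "E' = map_matrix fls_const E" and "B' = map_matrix fls_const B"
  have E': "E' ** B' = mat 1" "B' ** E' = mat 1"
    unfolding E'_def B'_def map_matrix_mult[OF hom, symmetric] E map_matrix_one[OF hom] by (rule refl)+
  have Xdiag: "diagonal_in E B X" by (rule lie_algebra_diagonal[OF Hdiag T(2)])
  have Tdiag: "diagonal_in E' B' T"
    using Xdiag
    unfolding diagonal_in_def E'_def B'_def T_def map_matrix_mult[OF hom, symmetric] nth_map_matrix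
    by simp
  have "w \<in> carrier (weyl_group G H)" using w(1) by (simp add: has_monodromy_def)
  then obtain n0 where n0: "n0 \<in> norm_group G H" "w = (\<lambda>h. h ** n0) ` H"
    by (rule weyl_group_coset)
  have inv: "invertible n0" "\<And>h. h \<in> H \<Longrightarrow> invertible h"
    using algebraic_group_mem(2)[OF G] n0(1) HG by (auto simp: norm_group_def)
  define m0 where "m0 = matrix_inv n0"
  have m0: "n0 ** m0 = mat 1" "m0 ** n0 = mat 1" unfolding m0_def using matrix_inv_mult[OF inv(1)] by auto
  define n where "n = Q ** map_matrix (deck d) q"
  have n: "n \<in> loop_pts w" using w(1) by (simp add: has_monodromy_def n_def Q_def)
  have "diagonal_in E B (x ** m0)" if x: "x \<in> w" for x
  proof -
    from x[unfolded n0(2)] obtain h where h: "x = h ** n0" "h \<in> H" by (rule imageE)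
    then show ?thesis using Hdiag[OF h(2)] by (simp only: matrix_cancel(2)[OF m0(1)])
  qed
  \<comment> \<open>The constant matrix \<open>m0\<close> is the inverse of the representative
    \<open>n0\<close>, so \<open>n\<close> is a diagonal Laurent series matrix times
    \<open>n0\<close>, in the basis of the torus.\<close>
  then have hdiag: "diagonal_in E' B' (n ** map_matrix fls_const m0)"
    unfolding E'_def B'_def by (intro loop_pts_diagonal[OF _ n])
  text \<open>Invariance under the deck transformation makes \<open>T\<close> commute with the monodromy \<open>n\<close>.\<close>
  define P where "P = map_matrix (pull d) N"
  have Pq: "P ** q = q ** T"
  proof -
    have "q ** T = q ** (Q ** (P ** q))"
      unfolding T_def T(1)[symmetric] P_def Q_def by (simp only: matrix_mul_assoc)
    then show ?thesis by (simp only: matrix_cancel(1)[OF Q(2)])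
  qed
  have "map_matrix (deck d) P = P" unfolding P_def using deck_pull[OF d] by (simp add: vec_eq_iff)
  moreover have "map_matrix (deck d) T = T" unfolding T_def by (simp add: vec_eq_iff deck_const)
  moreover have "map_matrix (deck d) q = q ** n"
    unfolding n_def by (rule matrix_cancel(1)[OF Q(2), symmetric])
  ultimately have "P ** (q ** n) = q ** n ** T"
    using arg_cong[OF Pq, of "map_matrix (deck d)"] by (simp add: map_matrix_mult[OF unital_hom_deck])
  then have "q ** (T ** n) = q ** (n ** T)" by (simp only: matrix_mul_assoc Pq)
  then have "Q ** (q ** (T ** n)) = Q ** (q ** (n ** T))" by simp
  then have Tn: "T ** n = n ** T" by (simp only: matrix_cancel(1)[OF Q(1)])
  have "invertible n" using n by (simp add: pts_def)
  then obtain m where m: "m ** n = mat 1" unfolding invertible_def by blast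
  \<comment> \<open>\<open>T\<close> commutes both with \<open>n\<close> and with the diagonal
    matrix \<open>n m0\<close>. Cancelling \<open>n\<close> leaves commutation with the constant
    matrix \<open>m0\<close>, hence a statement about complex matrices.\<close>
  have "n ** (T ** map_matrix fls_const m0) = T ** (n ** map_matrix fls_const m0)"
    by (simp only: matrix_mul_assoc Tn)
  also have "\<dots> = n ** map_matrix fls_const m0 ** T"
    by (rule diagonal_in_commute[OF E' Tdiag hdiag])
  finally have "n ** (T ** map_matrix fls_const m0) = n ** (map_matrix fls_const m0 ** T)"
    by (simp only: matrix_mul_assoc)
  then have "m ** (n ** (T ** map_matrix fls_const m0)) = m ** (n ** (map_matrix fls_const m0 ** T))"
    by simp
  then have "T ** map_matrix fls_const m0 = map_matrix fls_const m0 ** T"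
    by (simp only: matrix_cancel(1)[OF m])
  then have "X ** m0 = m0 ** X"
    unfolding T_def by - (rule map_matrix_const_inj, simp add: map_matrix_mult[OF hom])
  then have "n0 ** (X ** m0) ** n0 = n0 ** (m0 ** X) ** n0" by simp
  then have n0X: "n0 ** X = X ** n0"
    unfolding matrix_mul_assoc[symmetric] by (simp add: matrix_cancel(1)[OF m0(1)] m0)
  have "y ** X ** matrix_inv y = X" if y: "y \<in> w" for y
  proof -
    from y[unfolded n0(2)] obtain h where h: "y = h ** n0" "h \<in> H" by (rule imageE)
    have "invertible y" unfolding h(1) using inv h(2) by (intro invertible_mult)
    have "y ** X = h ** X ** n0" unfolding h(1) by (simp add: n0X flip: matrix_mul_assoc)
    also have "\<dots> = X ** y"
      unfolding h(1) diagonal_in_commute[OF E Hdiag[OF h(2)] Xdiag] by (simp add: matrix_mul_assoc)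
    finally show ?thesis
      by (simp only: matrix_cancel(2)[OF matrix_inv_mult(1)[OF \<open>invertible y\<close>]])
  qed
  then have "X = 0" using w(2) T(2) unfolding elliptic_def by blast
  then have "T = 0" unfolding T_def by (simp add: vec_eq_iff)
  then have "P ** q ** Q = 0" unfolding Pq by (simp add: vec_eq_iff matrix_matrix_mult_def)
  then have "P = 0" unfolding matrix_cancel(2)[OF Q(2)] .
  then show ?thesis using pull_eq_0_iff[OF d] unfolding P_def by (simp add: vec_eq_iff)
qed

section \<open>The connection defined by a string point\<close>

lemma cartan_subgroup_one:
  fixes H G :: "(complex^'n^'n) set"
  assumes "cartan_subgroup H G"
  shows "mat 1 \<in> H"
  using assms unfolding cartan_subgroup_def torus_def by (elim conjE) (rule algebraic_group_mem(1))

lemma cartan_loop_lie_commute: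
  fixes H G :: "(complex^'n^'n) set"
  assumes H: "cartan_subgroup H G" and X: "X \<in> loop_lie H" "Y \<in> loop_lie H"
  shows "X ** Y = Y ** X"
proof -
  have "torus H" using H unfolding cartan_subgroup_def by blast
  then obtain B :: "complex^'n^'n" where B: "invertible B"
      "\<forall>t\<in>H. \<forall>i j. i \<noteq> j \<longrightarrow> (matrix_inv B ** t ** B) $ i $ j = 0"
    unfolding torus_def by (elim conjE exE)
  define E where "E = matrix_inv B"
  have E: "E ** B = mat 1" "B ** E = mat 1" unfolding E_def using matrix_inv_mult[OF B(1)] by auto
  have Hdiag: "diagonal_in E B x" if "x \<in> H" for x
    unfolding diagonal_in_def E_def using bspec[OF B(2) that] .
  note hom = unital_hom_const
  have E': "map_matrix fls_const E ** map_matrix fls_const B = mat 1"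
      "map_matrix fls_const B ** map_matrix fls_const E = mat 1"
    unfolding map_matrix_mult[OF hom, symmetric] E map_matrix_one[OF hom] by (rule refl)+
  have diag: "diagonal_in (map_matrix fls_const E) (map_matrix fls_const B) X"
    if "X \<in> loop_lie H" for X
    by (rule loop_lie_diagonal[OF cartan_subgroup_one[OF H] _ that]) (rule Hdiag)
  show ?thesis by (rule diagonal_in_commute[OF E' diag[OF X(1)] diag[OF X(2)]])
qed

lemma matrix_vec_span_eq_0:
  assumes "\<And>s. s \<in> S \<Longrightarrow> N *v s = 0" "v \<in> span_over (*s) R S"
  shows "N *v v = (0 :: 'a::comm_ring_1^'m)"
proof -
  obtain T a where T: "v = (\<Sum>s\<in>T. a s *s s)" "T \<subseteq> S"
    using assms(2) unfolding span_over_def by blast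
  then show ?thesis
    unfolding T(1) matrix_vec_combination using assms(1) by (intro sum.neutral) auto
qed

theorem A0_stab_eq_0:
  fixes G H w :: "(complex^'n^'n) set" and q :: "complex fls^'n^'n" and V :: "(complex fls^'n) set"
  assumes C: "pointed_curve F" "has_genus F 0" and G: "algebraic_group G" and H: "cartan_subgroup H G"
    and d: "d > 0" and q: "invertible q" and w: "has_monodromy G H d q w" "elliptic H w"
    and V: "torsor_module F G V" and string: "string_point F G H d q V"
    and N0: "N0 \<in> A0_stab F G H d q V"
  shows "N0 = 0"
proof -
  obtain t where t: "t \<in> regular_functions F (affine_part F)" "fls_subdegree t = -1"
    using affine_coordinate_exists[OF C] .
  define f where "f = inverse (fls_deriv t)"
  note f = coordinate_vector_field[OF C(1) t, folded f_def]
  have "f \<in> fst ` A_stab F G H d q V"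
    using string f(1) unfolding string_point_def by simp
  then obtain M where "(f, M) \<in> A_stab F G H d q V" by force
  then have ME: "(f, M) \<in> atiyah_E G H d q" and MP: "(f, M) \<in> atiyah_P F G V"
    by (simp_all add: A_stab_def)
  obtain B and \<delta> :: "complex fls^'n^'n" and k0 where B: "finite B" "V = span_over (*s) (range (evl t)) B"
    and \<delta>: "invertible \<delta>" "\<forall>j. \<delta> *v axis j 1 \<in> span_over (*s) UNIV V"
    and disc: "\<forall>v\<in>V. (\<forall>i. vanishes_below k0 (v $ i)) \<longrightarrow> v = 0"
    using torsor_module_discrete[OF C(1) t V] .
  define Q where "Q = matrix_inv q"
  have Q: "Q ** q = mat 1" "q ** Q = mat 1" unfolding Q_def using matrix_inv_mult[OF q] by auto
  define Dz where "Dz = (\<lambda>x. f * fls_deriv x)"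
  \<comment> \<open>The lift of \<open>Dz\<close> to the cover with coordinate \<open>u\<close>,
    needed because the entries of \<open>q\<close> are series in \<open>u\<close>.\<close>
  define Du where "Du = (\<lambda>x. pull d f * dz d x)"
  have Dz: "derivation Dz" unfolding Dz_def by (rule derivation_scaled_deriv)
  have Du: "derivation Du" unfolding Du_def by (rule derivation_scaled_dz)
  have Du_const: "Du (fls_const c) = 0" for c by (simp add: Du_def dz_const)
  note hom = unital_hom_pull[OF d]
  have Du_pull: "Du (pull d x) = pull d (Dz x)" for x
    using hom by (simp add: Du_def Dz_def dz_pull[OF d] unital_hom_def)
  define P :: "complex fls^'n^'n \<Rightarrow> complex fls^'n^'n" where "P = map_matrix (pull d)"
  have Du_P: "map_matrix Du (P X) = P (map_matrix Dz X)" for X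
    by (simp add: P_def vec_eq_iff Du_pull)
  define M' where "M' = Q ** (P M ** q + map_matrix Du q)"
  have M': "M' \<in> loop_lie H"
  proof -
    have "mat_scale (pull d f) (map_matrix (dz d) q) = map_matrix Du q"
      by (simp add: mat_scale_def vec_eq_iff Du_def)
    then show ?thesis using ME by (simp add: atiyah_E_def M'_def P_def Q_def)
  qed
  define stab where "stab N \<longleftrightarrow> (\<forall>v\<in>V. N *v v \<in> V) \<and> Q ** P N ** q \<in> loop_lie H" for N
  \<comment> \<open>The commutator of \<open>f d/dz + M\<close> with \<open>N\<close>; the
    derivatives of the vector cancel, so it is again a matrix.\<close>
  define nabla where "nabla N = map_matrix Dz N + M ** N - N ** M" for N
  \<comment> \<open>\<open>M'\<close> is the matrix part of the operator in the frame
    \<open>q\<close>. It lies in the commutative Lie algebra containing the conjugate of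
    \<open>N\<close>, so their bracket disappears.\<close>
  have conj: "Q ** P (nabla N) ** q = map_matrix Du (Q ** P N ** q)" if "stab N" for N
  proof -
    define T where "T = Q ** P N ** q"
    have "P (nabla N) = map_matrix Du (P N) + P M ** P N - P N ** P M"
      unfolding nabla_def Du_P
      unfolding P_def map_matrix_add[OF hom] map_matrix_diff[OF hom] map_matrix_mult[OF hom] ..
    then have "Q ** P (nabla N) ** q = map_matrix Du T + M' ** T - T ** M'"
      using gauge_transform[OF Du Q T_def M'_def] by simp
    moreover have "M' ** T = T ** M'"
      using cartan_loop_lie_commute[OF H M'] that by (simp add: stab_def T_def)
    ultimately show ?thesis by (simp add: T_def)
  qed
  have stab_nabla: "stab (nabla N)" if N: "stab N" for N
    unfolding stab_def
  proof
    show "Q ** P (nabla N) ** q \<in> loop_lie H"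
      unfolding conj[OF N]
      by (rule loop_lie_derivation[OF cartan_subgroup_one[OF H] Du Du_const])
        (use N in \<open>simp add: stab_def\<close>)
    show "\<forall>v\<in>V. nabla N *v v \<in> V"
    proof
      fix v assume v: "v \<in> V"
      have op: "apply_op f M v \<in> V" if "v \<in> V" for v using MP that by (simp add: atiyah_P_def)
      have op_eq: "apply_op f M v = (\<chi> i. Dz (v $ i)) + M *v v" for v
        by (simp add: apply_op_def Dz_def)
      have "nabla N *v v = apply_op f M (N *v v) - N *v apply_op f M v"
        unfolding op_eq map_derivation_vec_mult[OF Dz] nabla_def
        by (simp add: matrix_vector_mult_add_rdistrib matrix_vector_mult_diff_rdistrib
            matrix_vector_right_distrib matrix_vector_mul_assoc)
      moreover have "apply_op f M (N *v v) \<in> V" "N *v apply_op f M v \<in> V"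
        using op v N by (simp_all add: stab_def)
      ultimately show "nabla N *v v \<in> V"
        using span_over_diff[OF subalg_range_evl B(1)] unfolding B(2) by simp
    qed
  qed
  have stab_iter: "stab ((nabla ^^ k) N)" if "stab N" for k N
    using that by (induction k) (auto simp: stab_nabla)
  \<comment> \<open>The conjugate of a horizontal \<open>N\<close> has constant entries because
    \<open>pull d f\<close> is nonzero, and constants are excluded by ellipticity.\<close>
  have nabla_inj: "N = 0" if N: "stab N" "nabla N = 0" for N
  proof -
    define T where "T = Q ** P N ** q"
    have "P 0 = 0" by (simp add: P_def vec_eq_iff unital_hom_0[OF hom])
    then have "map_matrix Du T = 0"
      using conj[OF N(1)] N(2) by (simp add: T_def vec_eq_iff matrix_matrix_mult_def)
    then have "dz d (T $ i $ j) = 0" for i j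
      using pull_eq_0_iff[OF d, of f] f(3) by (simp add: vec_eq_iff Du_def)
    then have T: "T = map_matrix fls_const (mat_coeff T 0)"
      by (intro map_matrix_const_mat_coeff dz_eq_0_imp_const[OF d])
    have "mat_coeff T 0 \<in> lie_algebra H"
      using N(1) by (simp add: stab_def T_def loop_lie_def)
    then show ?thesis
      using elliptic_no_constant_sections[OF G H d q w _ \<open>mat_coeff T 0 \<in> lie_algebra H\<close>, of N] T
      by (simp add: T_def P_def Q_def)
  qed
  have nilpotent: "\<exists>k. (nabla ^^ k) N = 0" if N: "stab N" for N
  proof -
    obtain a where a: "\<And>i j. vanishes_below a ((Q ** P N ** q) $ i $ j)"
      using matrix_vanishes_below[of "Q ** P N ** q"] by blast
    obtain b where b: "\<And>i j. vanishes_below b (q $ i $ j)"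
      using matrix_vanishes_below[of q] by blast
    obtain c where c: "\<And>i j. vanishes_below c (Q $ i $ j)"
      using matrix_vanishes_below[of Q] by blast
    \<comment> \<open>In the coordinate \<open>u\<close>, \<open>pull d f\<close> vanishes to order
      \<open>2 d\<close> and \<open>dz d\<close> lowers the order by \<open>d\<close>, so each step
      gains \<open>d\<close>.\<close>
    have grow: "vanishes_below (a + int k * int d) ((Q ** P ((nabla ^^ k) N) ** q) $ i $ j)" for k i j
    proof (induction k arbitrary: i j)
      case 0
      then show ?case using a by simp
    next
      case (Suc k)
      have "vanishes_below (int d * 2 + (a + int k * int d - int d))
          (Du ((Q ** P ((nabla ^^ k) N) ** q) $ i $ j))"
        unfolding Du_def
        by (intro vanishes_below_mult vanishes_below_dz Suc) (simp add: vanishes_below_pull[OF d] f(2))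
      then show ?case
        by (simp add: conj[OF stab_iter[OF N]] algebra_simps)
    qed
    have "finite (\<Union>v\<in>B. range (\<lambda>i. v $ i))" using B(1) by auto
    then obtain e where e: "\<And>x. x \<in> (\<Union>v\<in>B. range (\<lambda>i. v $ i)) \<Longrightarrow> vanishes_below e x"
      using finite_vanishes_below by blast
    \<comment> \<open>Returning from the frame costs \<open>b\<close> and \<open>c\<close>. The
      target is order \<open>k0 - e\<close> in \<open>z\<close>, that is \<open>d (k0 - e)\<close>
      in \<open>u\<close>; since the generators have order at least \<open>e\<close>, their images
      reach \<open>k0\<close>, where discreteness makes them zero. Because \<open>d\<close> is at
      least 1, \<open>k\<close> steps gain at least \<open>k\<close>.\<close>
    define k where "k = nat (int d * (k0 - e) - a - b - c)"
    define N' where "N' = (nabla ^^ k) N"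
    have stab': "stab N'" unfolding N'_def by (rule stab_iter[OF N])
    have PN': "vanishes_below (int d * (k0 - e)) (P N' $ i $ j)" for i j
    proof -
      have "P N' = q ** (Q ** P N' ** q) ** Q"
        unfolding matrix_mul_assoc[symmetric] matrix_cancel(1)[OF Q(2)] by (simp add: Q)
      moreover have "vanishes_below (b + (a + int k * int d) + c) ((q ** (Q ** P N' ** q) ** Q) $ i $ j)"
        unfolding N'_def by (intro matrix_mult_vanishes_below b c grow)
      moreover have "int d * (k0 - e) \<le> b + (a + int k * int d) + c"
      proof -
        have "int k * 1 \<le> int k * int d" using d by (intro mult_left_mono) auto
        moreover have "int d * (k0 - e) - a - b - c \<le> int k" by (simp add: k_def)
        ultimately show ?thesis by linarith
      qed
      ultimately show ?thesis using vanishes_below_mono by simp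
    qed
    then have N'_below: "vanishes_below (k0 - e) (N' $ i $ j)" for i j
      using vanishes_below_pull[OF d] by (simp add: P_def)
    have "N' *v b = 0" if "b \<in> B" for b
    proof (rule disc[rule_format])
      have "b = (\<Sum>s\<in>{b}. (\<lambda>_. 1) s *s s)" by simp
      then have "b \<in> V" unfolding B(2) span_over_def using that subalg_1[OF subalg_range_evl]
        by (intro CollectI exI[of _ "{b}"] exI[of _ "\<lambda>_. 1"]) auto
      then show "N' *v b \<in> V" using stab' by (simp add: stab_def)
      fix i
      have "vanishes_below (k0 - e + e) ((N' *v b) $ i)"
        by (intro matrix_vec_vanishes_below N'_below e) (use that in auto)
      then show "vanishes_below k0 ((N' *v b) $ i)" by simp
    qed
    then have NV: "N' *v v = 0" if "v \<in> V" for v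
      using matrix_vec_span_eq_0 that unfolding B(2) by blast
    have "N' *v (\<delta> *v axis j 1) = 0" for j
      using matrix_vec_span_eq_0[OF NV \<delta>(2)[rule_format]] .
    then have "(N' ** \<delta>) *v axis j 1 = 0" for j by (simp add: matrix_vector_mul_assoc)
    moreover have "((N' ** \<delta>) *v axis j 1) $ i = (N' ** \<delta>) $ i $ j" for i j
      by (simp add: matrix_vector_mult_def axis_def if_distrib cong: if_cong)
    ultimately have "N' ** \<delta> = 0" by (simp add: vec_eq_iff)
    then have "N' ** \<delta> ** matrix_inv \<delta> = 0" by (simp add: vec_eq_iff matrix_matrix_mult_def)
    then have "N' = 0" unfolding matrix_cancel(2)[OF matrix_inv_mult(1)[OF \<delta>(1)]] .
    then show ?thesis unfolding N'_def by blast
  qed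
  \<comment> \<open>Injectivity, applied to the iterates, removes them one by one from the
    last.\<close>
  have zero: "N = 0" if "(nabla ^^ k) N = 0" "stab N" for k N
    using that
  proof (induction k)
    case (Suc k)
    then show ?case using nabla_inj[OF stab_iter[OF Suc.prems(2), of k]] by simp
  qed simp
  have "stab N0"
    using N0 by (simp add: A0_stab_def heis_lie_def ad_P_def stab_def P_def Q_def)
  then show ?thesis using nilpotent zero by blast
qed

lemma zero_in_A0_stab:
  fixes G H :: "(complex^'n^'n) set" and q :: "complex fls^'n^'n"
  assumes "mat 1 \<in> G" "mat 1 \<in> H" "d > 0" "torsor_module F G V"
  shows "0 \<in> A0_stab F G H d q V"
proof -
  have "0 \<in> V" using assms(4) zero_in_span_over unfolding torsor_module_def by metis
  moreover have "map_matrix (pull d) (0 :: complex fls^'n^'n) = 0"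
    by (simp add: vec_eq_iff unital_hom_0[OF unital_hom_pull[OF assms(3)]])
  moreover have "matrix_inv q ** 0 ** q = 0" by (simp add: vec_eq_iff matrix_matrix_mult_def)
  ultimately show ?thesis
    using loop_lie_0[OF assms(1)] loop_lie_0[OF assms(2)]
    by (simp add: A0_stab_def heis_lie_def ad_P_def)
qed

lemma span_over_mat_scale_0:
  fixes R :: "'r::comm_ring_1 set"
  shows "span_over mat_scale R {0} = {0}"
proof -
  have scale: "mat_scale c 0 = 0" for c :: 'r by (simp add: mat_scale_def vec_eq_iff)
  have "v = 0" if "v \<in> span_over mat_scale R {0}" for v
    using that unfolding span_over_def by (auto simp: scale intro!: sum.neutral)
  then show ?thesis using zero_in_span_over by blast
qed

theorem theorem9:
  fixes F :: "complex fls set"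
    and G H w :: "(complex^'n^'n) set"
    and d :: nat
    and q :: "complex fls^'n^'n"
    and V :: "(complex fls^'n) set"
  assumes "pointed_curve F" and "has_genus F 0"
    and "semisimple_group G" and "simply_connected G"
    and "cartan_subgroup H G"
    and "regular_heisenberg G H d q"
    and "has_monodromy G H d q w" and "elliptic H w"
    and "V \<in> Gr_hat F G"
    and "string_point F G H d q V"
  shows "\<forall>U. open_affine_part F U \<longrightarrow> c_sections F G H d q V U = {0}"
proof -
  have G: "algebraic_group G" using assms(3) by (simp add: semisimple_group_def)
  have "heisenberg G H d q" using assms(6) by (simp add: regular_heisenberg_def)
  then have d: "d > 0" and q: "invertible q" by (simp_all add: heisenberg_def pts_def)
  have V: "torsor_module F G V" using assms(9) by (simp add: Gr_hat_def)
  \<comment> \<open>Over every open set the sections are spanned by this one module.\<close>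
  have "A0_stab F G H d q V = {0}"
    using A0_stab_eq_0[OF assms(1,2) G assms(5) d q assms(7,8) V assms(10)]
      zero_in_A0_stab[OF algebraic_group_mem(1)[OF G] cartan_subgroup_one[OF assms(5)] d V]
    by blast
  then show ?thesis by (simp add: c_sections_def span_over_mat_scale_0)
qed

end
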